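(* For each $n\ge 1$ consider a homogeneous Poisson point process of intensity $e^{n\rho_n}$ in $\mathbb{R}^n$, with $\rho_n\to\rho\in\mathbb{R}$, whose points $T_n^{(k)}$ carry i.i.d. marks $X_n^{(k)}\stackrel{d}{=}\bar X_n\ge 0$ independent of the points, the ball of the point $T_n^{(k)}$ being $B(T_n^{(k)},X_n^{(k)}\sqrt n)$. Assume that $R^*:=\lim_{n\to\infty}\mathbb{E}[\bar X_n]$ exists with $0<R^*<\infty$, that $(\bar X_n)_{n\ge1}$ satisfies a large deviations principle (speed $n$) with good convex rate function $I$, and that $\limsup_{n\to\infty}\mathbb{E}[(\bar X_n)^{\gamma n}]^{1/n}<\infty$ for some $\gamma>1$. Let $D_n$ be the number of points other than $\underline{0}$ whose ball intersects the ball of the point at the origin under the Palm probability $\mathbb{P}^0_n$. Then the degree threshold is $$\tau_d=-\tfrac12\log(2\pi e)+\inf_{R\ge 2R^*}\Bigl(2I\bigl(\tfrac R2\bigr)-\log R\Bigr).$$ That is, for $\rho<\tau_d$, $\mathbb{E}^0_n[D_n]$ tends to $0$ exponentially fast as $n\to\infty$, whereas for $\rho>\tau_d$ it tends to infinity exponentially fast. In both cases, $$\lim_{n\to\infty}\frac1n\log \mathbb{E}^0_n[D_n]=\rho-\tau_d.$$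
   Context: $\log$ is the natural logarithm. $B(t,r)$ is the closed Euclidean ball of center $t\in\mathbb{R}^n$ and radius $r\ge 0$, and $\underline{0}$ is the origin of $\mathbb{R}^n$. $\mathbb{P}^0_n$ (with expectation $\mathbb{E}^0_n$) is the Palm probability of the marked Poisson process in dimension $n$: under $\mathbb{P}^0_n$ the marked process is distributed as the superposition of the stationary marked Poisson process and an independent single point at $\underline{0}$ carrying a ball whose radius has the law of $\bar X_n\sqrt n$. A good rate function is a lower semicontinuous function $I:\mathbb{R}\to[0,\infty]$ with compact sublevel sets. The degree threshold is the number $\tau_d$ such that $\mathbb{E}^0_n[D_n]\to0$ for $\rho<\tau_d$ and $\mathbb{E}^0_n[D_n]\to\infty$ for $\rho>\tau_d$. Under the assumptions, $I(R^* )=0$. *)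

theory Defs
  imports "HOL-Probability.Probability"
begin

section \<open>Extended-real logarithm, root, exponential rates\<close>

definition elog :: "ennreal \<Rightarrow> ereal" where
  "elog x = (if x = 0 then -\<infinity> else if x = \<top> then \<infinity> else ereal (ln (enn2real x)))"

definition eroot :: "nat \<Rightarrow> ennreal \<Rightarrow> ennreal" where
  "eroot n x = (if x = \<top> then \<top> else ennreal (root n (enn2real x)))"

definition tends_to_zero_exp_fast :: "(nat \<Rightarrow> ennreal) \<Rightarrow> bool" where
  "tends_to_zero_exp_fast a \<longleftrightarrow>
     (\<exists>c>0. \<forall>\<^sub>F n in sequentially. a n \<le> ennreal (exp (- c * real n)))"

definition tends_to_infinity_exp_fast :: "(nat \<Rightarrow> ennreal) \<Rightarrow> bool" where
  "tends_to_infinity_exp_fast a \<longleftrightarrow>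
     (\<exists>c>0. \<forall>\<^sub>F n in sequentially. ennreal (exp (c * real n)) \<le> a n)"


section \<open>Large deviations on the real line\<close>

definition lower_semicontinuous :: "(real \<Rightarrow> ennreal) \<Rightarrow> bool" where
  "lower_semicontinuous I \<longleftrightarrow> (\<forall>x. I x \<le> Liminf (at x) I)"

definition good_rate_function :: "(real \<Rightarrow> ennreal) \<Rightarrow> bool" where
  "good_rate_function I \<longleftrightarrow>
     lower_semicontinuous I \<and> (\<forall>c::real. compact {x. I x \<le> ennreal c})"

text \<open>The library's \<^const>\<open>convex_on\<close> only covers real-valued functions.\<close>

definition convex_rate_function :: "(real \<Rightarrow> ennreal) \<Rightarrow> bool" where
  "convex_rate_function I \<longleftrightarrow>
     (\<forall>x y. \<forall>t\<in>{0..1}. I ((1 - t) * x + t * y) \<le> ennreal (1 - t) * I x + ennreal t * I y)"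

text \<open>Large deviations principle with speed \<open>n\<close> for a sequence of laws \<open>Q n\<close>.\<close>

definition large_deviations_principle :: "(nat \<Rightarrow> real measure) \<Rightarrow> (real \<Rightarrow> ennreal) \<Rightarrow> bool" where
  "large_deviations_principle Q I \<longleftrightarrow>
     (\<forall>F. closed F \<longrightarrow>
        limsup (\<lambda>n. elog (emeasure (Q n) F) / ereal (real n)) \<le> - (INF x\<in>F. enn2ereal (I x))) \<and>
     (\<forall>G. open G \<longrightarrow>
        - (INF x\<in>G. enn2ereal (I x)) \<le> liminf (\<lambda>n. elog (emeasure (Q n) G) / ereal (real n)))"


section \<open>Euclidean space of variable dimension\<close>

text \<open>Since the dimension tends to infinity, \<open>\<real>\<^sup>n\<close> is the space of functions on \<open>{..<n}\<close>
  (extended by \<^term>\<open>undefined\<close>), with the product Lebesgue measure.\<close>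

type_synonym point = "nat \<Rightarrow> real"

definition leb :: "nat \<Rightarrow> point measure" where
  "leb n = Pi\<^sub>M {..<n} (\<lambda>_. lborel)"

definition origin :: "nat \<Rightarrow> point" where
  "origin n = (\<lambda>i\<in>{..<n}. 0)"

definition closed_ball :: "nat \<Rightarrow> point \<Rightarrow> real \<Rightarrow> point set" where
  "closed_ball n t r = {y \<in> {..<n} \<rightarrow>\<^sub>E UNIV. L2_set (\<lambda>i. y i - t i) {..<n} \<le> r}"


section \<open>Marked Poisson processes and their Palm version\<close>

definition num_points :: "(nat \<Rightarrow> 'a \<Rightarrow> point) \<Rightarrow> point set \<Rightarrow> 'a \<Rightarrow> ennreal" where
  "num_points T A \<omega> = emeasure (count_space UNIV) {k. T k \<omega> \<in> A}"

text \<open>Independence of two random variables; the library's \<open>indep_var\<close> requires them to take values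
  in the same type.\<close>

definition (in prob_space) indep_pair ::
  "'b measure \<Rightarrow> ('a \<Rightarrow> 'b) \<Rightarrow> 'c measure \<Rightarrow> ('a \<Rightarrow> 'c) \<Rightarrow> bool" where
  "indep_pair MU U MV V \<longleftrightarrow> U \<in> M \<rightarrow>\<^sub>M MU \<and> V \<in> M \<rightarrow>\<^sub>M MV \<and>
     indep_set {U -` A \<inter> space M | A. A \<in> sets MU} {V -` B \<inter> space M | B. B \<in> sets MV}"

text \<open>Homogeneous Poisson process of intensity \<open>lam\<close> in \<open>\<real>\<^sup>n\<close>, its points enumerated as \<open>T k\<close>
  (infinitely many almost surely), with i.i.d. marks \<open>X k\<close> of law \<open>Q\<close> independent of the points.\<close>

locale marked_poisson_process = prob_space M
  for M :: "'a measure" +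
  fixes n :: nat and lam :: real and Q :: "real measure"
    and T :: "nat \<Rightarrow> 'a \<Rightarrow> point" and X :: "nat \<Rightarrow> 'a \<Rightarrow> real"
  assumes points_measurable: "\<And>k. T k \<in> M \<rightarrow>\<^sub>M leb n"
    and points_poisson: "\<And>A j. A \<in> sets (leb n) \<Longrightarrow> emeasure (leb n) A < \<top> \<Longrightarrow>
      prob {\<omega> \<in> space M. num_points T A \<omega> = of_nat j} =
        (lam * measure (leb n) A) ^ j / fact j * exp (- (lam * measure (leb n) A))"
    and points_indep: "\<And>(A :: nat \<Rightarrow> point set) J. finite J \<Longrightarrow> (\<forall>i\<in>J. A i \<in> sets (leb n)) \<Longrightarrow>
      disjoint_family_on A J \<Longrightarrow> indep_vars (\<lambda>_. borel) (\<lambda>i. num_points T (A i)) J"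
    and marks_measurable: "\<And>k. X k \<in> borel_measurable M"
    and marks_law: "\<And>k. distr M borel (X k) = Q"
    and marks_indep: "indep_vars (\<lambda>_. borel) X UNIV"
    and points_marks_indep:
      "indep_pair (Pi\<^sub>M UNIV (\<lambda>_. leb n)) (\<lambda>\<omega> k. T k \<omega>) (Pi\<^sub>M UNIV (\<lambda>_. borel)) (\<lambda>\<omega> k. X k \<omega>)"

text \<open>A probability space carrying the process under its Palm probability: the stationary marked
  process together with the independent mark \<open>X0\<close> of an additional point at the origin.\<close>

locale palm_marked_poisson_process = marked_poisson_process M n lam Q T X
  for M :: "'a measure" and n lam Q T X +
  fixes X0 :: "'a \<Rightarrow> real"
  assumes origin_mark_measurable: "X0 \<in> borel_measurable M"
    and origin_mark_law: "distr M borel X0 = Q"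
    and origin_mark_indep:
      "indep_pair borel X0 (Pi\<^sub>M UNIV (\<lambda>_. leb n \<Otimes>\<^sub>M borel)) (\<lambda>\<omega> k. (T k \<omega>, X k \<omega>))"

text \<open>The superposed configuration; index \<open>0\<close> is the point at the origin.\<close>

definition palm_configuration ::
  "nat \<Rightarrow> (nat \<Rightarrow> 'a \<Rightarrow> point) \<Rightarrow> (nat \<Rightarrow> 'a \<Rightarrow> real) \<Rightarrow> ('a \<Rightarrow> real) \<Rightarrow> 'a \<Rightarrow> nat \<Rightarrow> point \<times> real"
  where "palm_configuration n T X X0 \<omega> = case_nat (origin n, X0 \<omega>) (\<lambda>k. (T k \<omega>, X k \<omega>))"

definition marked_ball :: "nat \<Rightarrow> point \<times> real \<Rightarrow> point set" where
  "marked_ball n p = closed_ball n (fst p) (snd p * sqrt (real n))"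

definition degree_at_origin :: "nat \<Rightarrow> (nat \<Rightarrow> point \<times> real) \<Rightarrow> ennreal" where
  "degree_at_origin n c = emeasure (count_space UNIV)
     {j. fst (c j) \<noteq> origin n \<and> marked_ball n (c j) \<inter> marked_ball n (c 0) \<noteq> {}}"

definition palm_mean_degree ::
  "'a measure \<Rightarrow> nat \<Rightarrow> (nat \<Rightarrow> 'a \<Rightarrow> point) \<Rightarrow> (nat \<Rightarrow> 'a \<Rightarrow> real) \<Rightarrow> ('a \<Rightarrow> real) \<Rightarrow> ennreal" where
  "palm_mean_degree M n T X X0 =
     (\<integral>\<^sup>+ \<omega>. degree_at_origin n (palm_configuration n T X X0 \<omega>) \<partial>M)"

text \<open>The mean degree depends only on the joint law of the marked points and the origin mark, so
  realisations on the space of all values of these variables suffice in the definition below.\<close>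

type_synonym palm_sample = "(nat \<Rightarrow> point \<times> real) \<times> real"

definition is_degree_threshold :: "(nat \<Rightarrow> real measure) \<Rightarrow> real \<Rightarrow> bool" where
  "is_degree_threshold Q \<tau> \<longleftrightarrow>
     (\<forall>(\<rho>::real) (r :: nat \<Rightarrow> real) (M :: nat \<Rightarrow> palm_sample measure) T X X0.
        r \<longlonglongrightarrow> \<rho> \<longrightarrow>
        (\<forall>n\<ge>1. palm_marked_poisson_process (M n) n (exp (real n * r n)) (Q n) (T n) (X n) (X0 n)) \<longrightarrow>
        (\<rho> < \<tau> \<longrightarrow> (\<lambda>n. palm_mean_degree (M n) n (T n) (X n) (X0 n)) \<longlonglongrightarrow> 0) \<and>
        (\<tau> < \<rho> \<longrightarrow> (\<lambda>n. palm_mean_degree (M n) n (T n) (X n) (X0 n)) \<longlonglongrightarrow> \<top>))"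

end

theory Submission
  imports Defs "HOL-Real_Asymp.Real_Asymp"
begin

text \<open>
  The ball at the origin has radius \<open>X0 * sqrt n\<close>, and it meets a ball of radius \<open>X * sqrt n\<close> iff the
  centre of the latter is within \<open>(X0 + X) * sqrt n\<close> of the origin. Campbell's formula and
  independence therefore turn the mean degree into the intensity times the volume of the ball of
  radius \<open>sqrt n\<close>, whose rate is \<open>ln (2 * pi * exp 1) / 2\<close>, times the \<open>n\<close>-th moment of \<open>X + X'\<close>, for
  independent copies \<open>X\<close> and \<open>X'\<close> of the radius. By Laplace's method this moment has rate
  \<open>sup (ln (a + b) - I a - I b)\<close>, the moment condition excluding a contribution of large radii.
  By convexity of \<open>I\<close> the supremum may be restricted to \<open>a = b\<close>, and since \<open>I R* = 0\<close> also to
  \<open>a \<ge> R*\<close>.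
\<close>

section \<open>The mean degree as a moment of the radii\<close>

text \<open>The law of a single point \<open>T k\<close> depends on the enumeration and is unknown;
  only the sum of these laws over \<open>k\<close> is determined, as the intensity times Lebesgue
  measure. The sum must therefore be moved inside the integrals over the radii before it can be
  evaluated. The large deviations principle speaks of one radius and of one set at a time, with
  rates that may be infinite, whereas the moment couples two radii. Half-lines \<open>{a..}\<close>
  bridge this gap: the integrand increases in both radii, and the infimum of \<open>I\<close> over
  \<open>{a..}\<close> is the value of \<open>I\<close> at the larger of \<open>a\<close> and R*,
  which is again convex in \<open>a\<close>. Finitely many half-lines, with rates cut off at a
  finite level, suffice at the price of an arbitrarily small exponent. That \<open>I\<close>
  vanishes at R* is derived from the convergence of the means, with the moment condition providing
  uniform integrability. All conclusions are read off from two-sided bounds on the mean degree with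
  an error \<open>exp (n * e)\<close> for every \<open>e > 0\<close>.\<close>

lemma (in prob_space) indep_pair_distr:
  assumes ind: "indep_pair MU U MV V"
    and f: "f \<in> MU \<rightarrow>\<^sub>M MU'" and g: "g \<in> MV \<rightarrow>\<^sub>M MV'"
  shows "distr M (MU' \<Otimes>\<^sub>M MV') (\<lambda>\<omega>. (f (U \<omega>), g (V \<omega>))) =
    distr M MU' (\<lambda>\<omega>. f (U \<omega>)) \<Otimes>\<^sub>M distr M MV' (\<lambda>\<omega>. g (V \<omega>))"
proof -
  have U[measurable]: "U \<in> M \<rightarrow>\<^sub>M MU" and V[measurable]: "V \<in> M \<rightarrow>\<^sub>M MV"
    and I: "indep_set {U -` A \<inter> space M | A. A \<in> sets MU} {V -` B \<inter> space M | B. B \<in> sets MV}"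
    using ind by (auto simp: indep_pair_def)
  note f[measurable] g[measurable]
  interpret A: prob_space "distr M MU' (\<lambda>\<omega>. f (U \<omega>))" by (rule prob_space_distr) simp
  interpret B: prob_space "distr M MV' (\<lambda>\<omega>. g (V \<omega>))" by (rule prob_space_distr) simp
  show ?thesis
  proof (rule pair_measure_eqI[symmetric])
    fix A B assume "A \<in> sets (distr M MU' (\<lambda>\<omega>. f (U \<omega>)))" "B \<in> sets (distr M MV' (\<lambda>\<omega>. g (V \<omega>)))"
    then have AB[measurable]: "A \<in> sets MU'" "B \<in> sets MV'" by auto
    have eqs: "(\<lambda>\<omega>. f (U \<omega>)) -` A \<inter> space M = U -` (f -` A \<inter> space MU) \<inter> space M"
      "(\<lambda>\<omega>. g (V \<omega>)) -` B \<inter> space M = V -` (g -` B \<inter> space MV) \<inter> space M"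
      using measurable_space[OF U] measurable_space[OF V] by auto
    have "prob ((U -` (f -` A \<inter> space MU) \<inter> space M) \<inter> (V -` (g -` B \<inter> space MV) \<inter> space M)) =
      prob (U -` (f -` A \<inter> space MU) \<inter> space M) * prob (V -` (g -` B \<inter> space MV) \<inter> space M)"
      using measurable_sets[OF f AB(1)] measurable_sets[OF g AB(2)] by (intro indep_setD[OF I]) blast+
    then have "emeasure M (((\<lambda>\<omega>. f (U \<omega>)) -` A \<inter> space M) \<inter> ((\<lambda>\<omega>. g (V \<omega>)) -` B \<inter> space M)) =
      emeasure M ((\<lambda>\<omega>. f (U \<omega>)) -` A \<inter> space M) * emeasure M ((\<lambda>\<omega>. g (V \<omega>)) -` B \<inter> space M)"
      unfolding eqs[symmetric] by (simp add: emeasure_eq_measure ennreal_mult)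
    moreover have "(\<lambda>\<omega>. (f (U \<omega>), g (V \<omega>))) -` (A \<times> B) \<inter> space M =
       ((\<lambda>\<omega>. f (U \<omega>)) -` A \<inter> space M) \<inter> ((\<lambda>\<omega>. g (V \<omega>)) -` B \<inter> space M)" by auto
    ultimately show "emeasure (distr M MU' (\<lambda>\<omega>. f (U \<omega>))) A * emeasure (distr M MV' (\<lambda>\<omega>. g (V \<omega>))) B =
      emeasure (distr M (MU' \<Otimes>\<^sub>M MV') (\<lambda>\<omega>. (f (U \<omega>), g (V \<omega>)))) (A \<times> B)"
      by (subst (1 2 3) emeasure_distr) auto
  qed (auto intro: A.sigma_finite_measure_axioms B.sigma_finite_measure_axioms sets_pair_measure_cong)
qed

section \<open>Mean measure of the Poisson process\<close>

lemma num_points_eq_suminf: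
  "num_points T A \<omega> = (\<Sum>k. indicator A (T k \<omega>))"
proof -
  have "num_points T A \<omega> = (\<integral>\<^sup>+k. indicator {k. T k \<omega> \<in> A} k \<partial>count_space UNIV)"
    unfolding num_points_def by simp
  also have "\<dots> = (\<Sum>k. indicator {k. T k \<omega> \<in> A} k)"
    by (rule nn_integral_count_space_nat)
  finally show ?thesis by (simp add: indicator_def)
qed

text \<open>Only the probabilities of finite counts are given. The Poisson weights sum to one, so
  the count is finite almost surely, and \<open>x * p j = (j + 1) * p (j + 1)\<close> yields its
  mean \<open>x\<close>. On the other side the count is a sum of indicators over \<open>k\<close>,
  whose integrals are the laws of the single points.\<close>

lemma (in marked_poisson_process) mean_num_points:
  assumes A[measurable]: "A \<in> sets (leb n)" and fin: "emeasure (leb n) A < \<top>" and lam: "0 \<le> lam"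
  shows "(\<Sum>k. emeasure (distr M (leb n) (T k)) A) = ennreal (lam * measure (leb n) A)"
proof -
  note points_measurable[measurable]
  define x where "x = lam * measure (leb n) A"
  have x: "0 \<le> x" using lam by (simp add: x_def)
  define p where "p j = x ^ j / fact j * exp (- x)" for j :: nat
  let ?N = "num_points T A"
  have meas[measurable]: "?N \<in> borel_measurable M"
    unfolding num_points_eq_suminf by measurable
  define E where "E j = {\<omega> \<in> space M. ?N \<omega> = of_nat j}" for j :: nat
  have E[measurable]: "E j \<in> sets M" for j unfolding E_def by measurable
  have pE: "prob (E j) = p j" for j
    using points_poisson[OF A fin] by (simp add: E_def p_def x_def)
  have p_sums: "p sums 1"
  proof -
    have "(\<lambda>j. (x ^ j /\<^sub>R fact j) * exp (-x)) sums (exp x * exp (-x))"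
      by (intro sums_mult2 exp_converges)
    then show ?thesis by (simp add: p_def[abs_def] exp_minus divide_inverse mult.commute)
  qed
  have mean_sums: "(\<lambda>j. real j * p j) sums x"
  proof -
    have "(\<lambda>j. x * p j) sums (x * 1)" by (intro sums_mult p_sums)
    moreover have "x * p j = real (Suc j) * p (Suc j)" for j
      by (simp add: p_def del: of_nat_Suc)
    ultimately have "(\<lambda>j. real (Suc j) * p (Suc j)) sums x" by simp
    then show ?thesis by (subst (asm) sums_Suc_iff) simp
  qed
  have disj: "disjoint_family E" by (auto simp: disjoint_family_on_def E_def)
  have "prob (\<Union>j. E j) = 1"
    using sums_unique2[OF finite_measure_UNION[OF _ disj]] p_sums pE by fastforce
  then have "AE \<omega> in M. \<omega> \<in> (\<Union>j. E j)" by (subst prob_eq_1[symmetric]) auto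
  then have "AE \<omega> in M. ?N \<omega> = (\<Sum>j. of_nat j * indicator (E j) \<omega>)"
  proof eventually_elim
    case (elim \<omega>)
    then obtain i where i: "\<omega> \<in> E i" by auto
    then have "indicator (E j) \<omega> = (if j = i then 1 else 0 :: ennreal)" for j
      using disj by (auto simp: disjoint_family_on_def indicator_def)
    then have "(\<Sum>j. of_nat j * indicator (E j) \<omega>) = (\<Sum>j. if j = i then of_nat j else 0 :: ennreal)"
      by (intro suminf_cong) auto
    also have "\<dots> = of_nat i" by (subst suminf_finite[of "{i}"]) auto
    finally show ?case using i by (simp add: E_def)
  qed
  then have "(\<integral>\<^sup>+\<omega>. ?N \<omega> \<partial>M) = (\<integral>\<^sup>+\<omega>. (\<Sum>j. of_nat j * indicator (E j) \<omega>) \<partial>M)"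
    by (rule nn_integral_cong_AE)
  also have "\<dots> = (\<Sum>j. of_nat j * emeasure M (E j))"
    by (subst nn_integral_suminf) (auto simp: nn_integral_cmult_indicator)
  also have "\<dots> = (\<Sum>j. ennreal (real j * p j))"
    by (simp add: emeasure_eq_measure pE ennreal_mult' ennreal_of_nat_eq_real_of_nat)
  also have "\<dots> = ennreal x"
    by (rule suminf_ennreal_eq[OF _ mean_sums]) (use x in \<open>auto simp: p_def\<close>)
  finally have "(\<integral>\<^sup>+\<omega>. ?N \<omega> \<partial>M) = ennreal x" .
  moreover have "(\<integral>\<^sup>+\<omega>. ?N \<omega> \<partial>M) = (\<Sum>k. emeasure (distr M (leb n) (T k)) A)"
    unfolding num_points_eq_suminf
    by (subst nn_integral_suminf, measurable, intro suminf_cong)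
      (simp add: nn_integral_distr[symmetric, of _ M "leb n"])
  ultimately show ?thesis by (simp add: x_def)
qed

section \<open>Geometry and volume of Euclidean balls\<close>

lemma space_leb: "space (leb n) = {..<n} \<rightarrow>\<^sub>E UNIV"
  by (simp add: leb_def space_PiM)

lemma measurable_L2_norm[measurable]: "(\<lambda>t. L2_set t {..<n}) \<in> borel_measurable (leb n)"
  unfolding L2_set_def leb_def by measurable

lemma emeasure_leb_ball:
  assumes "0 < r"
  shows "emeasure (leb n) {t \<in> space (leb n). L2_set t {..<n} \<le> r} = ennreal (unit_ball_vol (real n) * r ^ n)"
proof -
  have "{t \<in> space (leb n). L2_set t {..<n} \<le> r} =
    {f. sqrt (\<Sum>i\<in>{..<n}. (f i)\<^sup>2) \<le> r} \<inter> space (Pi\<^sub>M {..<n} (\<lambda>_. lborel))"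
    by (auto simp: leb_def L2_set_def)
  then show ?thesis unfolding leb_def using emeasure_cball_aux[of "{..<n}" r] assms by simp
qed

lemma L2_norm_eq_0_iff:
  assumes "t \<in> space (leb n)"
  shows "L2_set t {..<n} = 0 \<longleftrightarrow> t = origin n"
  using assms by (auto simp: space_leb origin_def L2_set_eq_0_iff PiE_iff extensional_def fun_eq_iff)

text \<open>The degree does not count points at the origin, hence the puncture. For
  \<open>n >= 1\<close> it removes a null set, as the origin lies in balls of arbitrarily small
  volume. Radius 0 is included because both radii may vanish.\<close>

lemma emeasure_leb_punctured_ball:
  assumes "1 \<le> n" "0 \<le> r"
  shows "emeasure (leb n) {t \<in> space (leb n). t \<noteq> origin n \<and> L2_set t {..<n} \<le> r} =
    ennreal (unit_ball_vol (real n) * r ^ n)"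
proof (cases "r = 0")
  case True
  have "L2_set t {..<n} \<le> r \<longleftrightarrow> L2_set t {..<n} = 0" for t
    by (metis True L2_set_nonneg order.antisym order.refl)
  then have "{t \<in> space (leb n). t \<noteq> origin n \<and> L2_set t {..<n} \<le> r} = {}"
    using L2_norm_eq_0_iff by auto
  moreover have "unit_ball_vol (real n) * r ^ n = 0" using True assms by simp
  ultimately show ?thesis by (simp only: emeasure_empty ennreal_0)
next
  case False
  then have r: "0 < r" using assms by simp
  define Z where "Z = {t \<in> space (leb n). L2_set t {..<n} = 0}"
  have Z[measurable]: "Z \<in> sets (leb n)" unfolding Z_def by measurable
  have le: "emeasure (leb n) Z \<le> ennreal (unit_ball_vol (real n) * e ^ n)" if "0 < e" for e
    unfolding emeasure_leb_ball[OF that, symmetric]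
    by (intro emeasure_mono) (use that in \<open>auto simp: Z_def\<close>)
  have "((\<lambda>e. ennreal (unit_ball_vol (real n) * e ^ n)) \<longlongrightarrow> ennreal (unit_ball_vol (real n) * 0 ^ n)) (at_right 0)"
    by (intro tendsto_ennrealI tendsto_intros)
  moreover have "\<forall>\<^sub>F e in at_right (0::real). emeasure (leb n) Z \<le> ennreal (unit_ball_vol (real n) * e ^ n)"
    using le by (auto simp: eventually_at_right_field intro!: exI[of _ 1])
  ultimately have "emeasure (leb n) Z \<le> ennreal (unit_ball_vol (real n) * 0 ^ n)"
    by (intro tendsto_lowerbound) auto
  also have "unit_ball_vol (real n) * 0 ^ n = 0" using assms by simp
  finally have Z0: "emeasure (leb n) Z = 0" by simp
  have "emeasure (leb n) {t \<in> space (leb n). L2_set t {..<n} \<le> r} =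
    emeasure (leb n) ({t \<in> space (leb n). L2_set t {..<n} \<le> r} - Z)"
    using Z0 by (intro emeasure_Diff_null_set[symmetric]) (auto simp: null_sets_def)
  also have "{t \<in> space (leb n). L2_set t {..<n} \<le> r} - Z =
    {t \<in> space (leb n). t \<noteq> origin n \<and> L2_set t {..<n} \<le> r}"
    using L2_norm_eq_0_iff by (auto simp: Z_def)
  finally show ?thesis using emeasure_leb_ball[OF r] by simp
qed

text \<open>The triangle inequality through a common point gives one direction. For the other, the
  point dividing the segment from the origin to \<open>t\<close> in the ratio \<open>a : b\<close>
  lies in both balls.\<close>

lemma closed_balls_meet_iff:
  assumes t: "t \<in> space (leb n)" and ab: "0 \<le> a" "0 \<le> b"
  shows "closed_ball n t b \<inter> closed_ball n (origin n) a \<noteq> {} \<longleftrightarrow> L2_set t {..<n} \<le> a + b"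
proof
  assume "closed_ball n t b \<inter> closed_ball n (origin n) a \<noteq> {}"
  then obtain y where y: "L2_set (\<lambda>i. y i - t i) {..<n} \<le> b" "L2_set (\<lambda>i. y i - origin n i) {..<n} \<le> a"
    by (auto simp: closed_ball_def)
  have o: "L2_set (\<lambda>i. y i - origin n i) {..<n} = L2_set y {..<n}"
    by (intro L2_set_cong) (auto simp: origin_def)
  have "L2_set t {..<n} = L2_set (\<lambda>i. y i + - (y i - t i)) {..<n}" by simp
  also have "\<dots> \<le> L2_set y {..<n} + L2_set (\<lambda>i. - (y i - t i)) {..<n}"
    by (rule L2_set_triangle_ineq)
  also have "L2_set (\<lambda>i. - (y i - t i)) {..<n} = L2_set (\<lambda>i. y i - t i) {..<n}"
    unfolding L2_set_def by (simp add: power2_commute)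
  finally show "L2_set t {..<n} \<le> a + b" using y o by simp
next
  assume le: "L2_set t {..<n} \<le> a + b"
  define c where "c = (if a + b = 0 then 0 else a / (a + b))"
  have c: "0 \<le> c" "c \<le> 1" and ca: "c * (a + b) = a"
    using ab by (auto simp: c_def)
  then have cb: "(1 - c) * (a + b) = b" by (simp add: algebra_simps)
  define y where "y = (\<lambda>i\<in>{..<n}. c * t i)"
  have "L2_set (\<lambda>i. y i - origin n i) {..<n} = L2_set (\<lambda>i. c * t i) {..<n}"
    by (intro L2_set_cong) (auto simp: y_def origin_def)
  also have "\<dots> = c * L2_set t {..<n}" using c by (simp add: L2_set_right_distrib)
  also have "\<dots> \<le> a" using mult_left_mono[OF le c(1)] ca by simp
  finally have 1: "L2_set (\<lambda>i. y i - origin n i) {..<n} \<le> a" .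
  have "L2_set (\<lambda>i. y i - t i) {..<n} = L2_set (\<lambda>i. (1 - c) * t i) {..<n}"
    unfolding L2_set_def by (intro arg_cong[of _ _ sqrt] sum.cong)
      (auto simp: y_def power2_eq_square algebra_simps)
  also have "\<dots> = (1 - c) * L2_set t {..<n}" using c by (simp add: L2_set_right_distrib)
  also have "\<dots> \<le> b" using mult_left_mono[OF le, of "1 - c"] c cb by simp
  finally have 2: "L2_set (\<lambda>i. y i - t i) {..<n} \<le> b" .
  have "y \<in> closed_ball n t b \<inter> closed_ball n (origin n) a"
    using 1 2 by (auto simp: closed_ball_def y_def)
  then show "closed_ball n t b \<inter> closed_ball n (origin n) a \<noteq> {}" by blast
qed

text \<open>Index 0 carries the origin, which the degree discards; the remaining indices are
  successors, one for each point of the stationary process.\<close>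

lemma degree_at_origin_palm:
  "degree_at_origin n (palm_configuration n T X X0 \<omega>) =
    (\<Sum>k. indicator {k. T k \<omega> \<noteq> origin n \<and>
       marked_ball n (T k \<omega>, X k \<omega>) \<inter> marked_ball n (origin n, X0 \<omega>) \<noteq> {}} k)"
proof -
  let ?c = "palm_configuration n T X X0 \<omega>"
  let ?K = "{k. T k \<omega> \<noteq> origin n \<and> marked_ball n (T k \<omega>, X k \<omega>) \<inter> marked_ball n (origin n, X0 \<omega>) \<noteq> {}}"
  have "{j. fst (?c j) \<noteq> origin n \<and> marked_ball n (?c j) \<inter> marked_ball n (?c 0) \<noteq> {}} = Suc ` ?K"
    by (auto simp: palm_configuration_def image_iff gr0_conv_Suc split: nat.splits)
  then have "degree_at_origin n ?c = emeasure (count_space UNIV) (Suc ` ?K)"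
    by (simp add: degree_at_origin_def)
  also have "\<dots> = emeasure (count_space UNIV) ?K"
    by (simp add: emeasure_count_space finite_image_iff card_image)
  also have "\<dots> = (\<integral>\<^sup>+k. indicator ?K k \<partial>count_space UNIV)" by simp
  also have "\<dots> = (\<Sum>k. indicator ?K k)" by (rule nn_integral_count_space_nat)
  finally show ?thesis .
qed

lemma (in palm_marked_poisson_process) palm_mean_degree_eq:
  assumes n: "1 \<le> n" and lam: "0 \<le> lam" and nonneg: "AE x in Q. 0 \<le> x"
  shows "palm_mean_degree M n T X X0 = ennreal (lam * unit_ball_vol (real n) * sqrt (real n) ^ n) *
    (\<integral>\<^sup>+x. \<integral>\<^sup>+y. ennreal ((x + y) ^ n) \<partial>Q \<partial>Q)"
proof -
  note points_measurable[measurable] marks_measurable[measurable] origin_mark_measurable[measurable]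
  have Q: "prob_space Q" "sets Q = sets borel"
    using prob_space_distr[OF origin_mark_measurable] origin_mark_law by auto
  note Q(2)[measurable_cong]
  interpret Q: prob_space Q by fact
  define A where "A s = {t \<in> space (leb n). t \<noteq> origin n \<and> L2_set t {..<n} \<le> s * sqrt (real n)}" for s
  \<comment> \<open>Written with the norm, the exclusion of the origin is a measurable condition,
    also jointly in the point and the radii.\<close>
  have A_alt: "A s = {t \<in> space (leb n). L2_set t {..<n} \<noteq> 0 \<and> L2_set t {..<n} \<le> s * sqrt (real n)}" for s
    using L2_norm_eq_0_iff by (auto simp: A_def)
  have A[measurable]: "A s \<in> sets (leb n)" for s unfolding A_alt by measurable
  define g :: "real \<times> point \<times> real \<Rightarrow> ennreal" where "g = (\<lambda>(x, t, y). indicator (A (x + y)) t)"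
  have g[measurable]: "g \<in> borel_measurable (borel \<Otimes>\<^sub>M (leb n \<Otimes>\<^sub>M borel))"
  proof -
    have "(\<lambda>z. if L2_set (fst (snd z)) {..<n} \<noteq> 0 \<and>
        L2_set (fst (snd z)) {..<n} \<le> (fst z + snd (snd z)) * sqrt (real n) then 1 else 0 :: ennreal)
      \<in> borel_measurable (borel \<Otimes>\<^sub>M (leb n \<Otimes>\<^sub>M borel))" by measurable
    then show ?thesis
      by (rule measurable_cong[THEN iffD1, rotated]) (auto simp: g_def A_alt space_pair_measure)
  qed
  \<comment> \<open>The independence assumptions concern whole sequences; projecting them to
    coordinate \<open>k\<close> makes the joint law of the origin mark and one marked point a
    product.\<close>
  have law_k: "distr M (borel \<Otimes>\<^sub>M (leb n \<Otimes>\<^sub>M borel)) (\<lambda>\<omega>. (X0 \<omega>, T k \<omega>, X k \<omega>)) =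
    Q \<Otimes>\<^sub>M (distr M (leb n) (T k) \<Otimes>\<^sub>M Q)" for k
  proof -
    have "distr M (leb n \<Otimes>\<^sub>M borel) (\<lambda>\<omega>. (T k \<omega>, X k \<omega>)) = distr M (leb n) (T k) \<Otimes>\<^sub>M distr M borel (X k)"
      by (rule indep_pair_distr[OF points_marks_indep, of "\<lambda>z. z k" _ "\<lambda>z. z k"]) auto
    moreover have "distr M (borel \<Otimes>\<^sub>M (leb n \<Otimes>\<^sub>M borel)) (\<lambda>\<omega>. (X0 \<omega>, T k \<omega>, X k \<omega>)) =
      distr M borel X0 \<Otimes>\<^sub>M distr M (leb n \<Otimes>\<^sub>M borel) (\<lambda>\<omega>. (T k \<omega>, X k \<omega>))"
      by (rule indep_pair_distr[OF origin_mark_indep, of "\<lambda>z. z" _ "\<lambda>z. z k"]) auto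
    ultimately show ?thesis by (simp add: marks_law origin_mark_law)
  qed
  have "AE \<omega> in M. 0 \<le> X0 \<omega>"
    using nonneg unfolding origin_mark_law[symmetric] by (subst (asm) AE_distr_iff) auto
  moreover have "AE \<omega> in M. 0 \<le> X k \<omega>" for k
    using nonneg unfolding marks_law[symmetric, of k] by (subst (asm) AE_distr_iff) auto
  then have "AE \<omega> in M. \<forall>k. 0 \<le> X k \<omega>" by (simp add: AE_all_countable)
  moreover have "AE \<omega> in M. \<omega> \<in> space M" by simp
  ultimately have "AE \<omega> in M. degree_at_origin n (palm_configuration n T X X0 \<omega>) =
    (\<Sum>k. g (X0 \<omega>, T k \<omega>, X k \<omega>))"
  proof eventually_elim
    case (elim \<omega>)
    have "T k \<omega> \<in> space (leb n)" for k using elim measurable_space[OF points_measurable] by auto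
    then show ?case unfolding degree_at_origin_palm using elim
      by (intro suminf_cong) (auto simp: g_def A_def marked_ball_def closed_balls_meet_iff
        algebra_simps split: split_indicator)
  qed
  then have "palm_mean_degree M n T X X0 = (\<integral>\<^sup>+\<omega>. (\<Sum>k. g (X0 \<omega>, T k \<omega>, X k \<omega>)) \<partial>M)"
    unfolding palm_mean_degree_def by (rule nn_integral_cong_AE)
  also have "\<dots> = (\<Sum>k. \<integral>\<^sup>+\<omega>. g (X0 \<omega>, T k \<omega>, X k \<omega>) \<partial>M)"
    by (rule nn_integral_suminf) measurable
  also have "\<dots> = (\<Sum>k. \<integral>\<^sup>+x. \<integral>\<^sup>+y. emeasure (distr M (leb n) (T k)) (A (x + y)) \<partial>Q \<partial>Q)"
  proof (rule suminf_cong)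
    fix k
    interpret P: prob_space "distr M (leb n) (T k)" by (rule prob_space_distr) simp
    interpret PQ: pair_prob_space "distr M (leb n) (T k)" Q ..
    have "(\<integral>\<^sup>+\<omega>. g (X0 \<omega>, T k \<omega>, X k \<omega>) \<partial>M) =
      (\<integral>\<^sup>+z. g z \<partial>(Q \<Otimes>\<^sub>M (distr M (leb n) (T k) \<Otimes>\<^sub>M Q)))"
      unfolding law_k[symmetric] by (subst nn_integral_distr) auto
    also have "\<dots> = (\<integral>\<^sup>+x. \<integral>\<^sup>+w. g (x, w) \<partial>(distr M (leb n) (T k) \<Otimes>\<^sub>M Q) \<partial>Q)"
      by (rule PQ.P.nn_integral_fst[symmetric]) measurable
    also have "\<dots> = (\<integral>\<^sup>+x. \<integral>\<^sup>+y. \<integral>\<^sup>+t. g (x, t, y) \<partial>distr M (leb n) (T k) \<partial>Q \<partial>Q)"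
      by (intro nn_integral_cong PQ.nn_integral_snd[symmetric]) measurable
    also have "\<dots> = (\<integral>\<^sup>+x. \<integral>\<^sup>+y. emeasure (distr M (leb n) (T k)) (A (x + y)) \<partial>Q \<partial>Q)"
      by (simp add: g_def)
    finally show "(\<integral>\<^sup>+\<omega>. g (X0 \<omega>, T k \<omega>, X k \<omega>) \<partial>M) =
       (\<integral>\<^sup>+x. \<integral>\<^sup>+y. emeasure (distr M (leb n) (T k)) (A (x + y)) \<partial>Q \<partial>Q)" .
  qed
  also have "\<dots> = (\<integral>\<^sup>+x. \<integral>\<^sup>+y. (\<Sum>k. emeasure (distr M (leb n) (T k)) (A (x + y))) \<partial>Q \<partial>Q)"
  proof -
    have m: "(\<lambda>(x, y). emeasure (distr M (leb n) (T k)) (A (x + y))) \<in> borel_measurable (Q \<Otimes>\<^sub>M Q)" for k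
    proof -
      interpret P: prob_space "distr M (leb n) (T k)" by (rule prob_space_distr) simp
      have "(\<lambda>z. \<integral>\<^sup>+t. g (fst z, t, snd z) \<partial>distr M (leb n) (T k)) \<in> borel_measurable (Q \<Otimes>\<^sub>M Q)"
        by measurable
      then show ?thesis by (simp add: g_def split_beta')
    qed
    note m[measurable]
    show ?thesis
      by (subst nn_integral_suminf[symmetric], measurable, intro nn_integral_cong
        nn_integral_suminf[symmetric]) measurable
  qed
  also have "\<dots> = (\<integral>\<^sup>+x. \<integral>\<^sup>+y. ennreal (lam * unit_ball_vol (real n) * sqrt (real n) ^ n) * ennreal ((x + y) ^ n) \<partial>Q \<partial>Q)"
  proof (rule nn_integral_cong_AE, use nonneg in eventually_elim, rule nn_integral_cong_AE, use nonneg in eventually_elim)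
    fix x y :: real assume xy: "0 \<le> x" "0 \<le> y"
    then have e: "emeasure (leb n) (A (x + y)) = ennreal (unit_ball_vol (real n) * ((x + y) * sqrt (real n)) ^ n)"
      unfolding A_def by (intro emeasure_leb_punctured_ball n) simp
    then have m: "measure (leb n) (A (x + y)) = unit_ball_vol (real n) * ((x + y) * sqrt (real n)) ^ n"
      using xy by (simp add: measure_def)
    have "(\<Sum>k. emeasure (distr M (leb n) (T k)) (A (x + y))) = ennreal (lam * measure (leb n) (A (x + y)))"
      by (rule mean_num_points) (use e lam in auto)
    also have "\<dots> = ennreal ((lam * unit_ball_vol (real n) * sqrt (real n) ^ n) * (x + y) ^ n)"
      unfolding m by (simp add: power_mult_distrib mult_ac)
    also have "\<dots> = ennreal (lam * unit_ball_vol (real n) * sqrt (real n) ^ n) * ennreal ((x + y) ^ n)"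
      using xy lam by (intro ennreal_mult) auto
    finally show "(\<Sum>k. emeasure (distr M (leb n) (T k)) (A (x + y))) =
      ennreal (lam * unit_ball_vol (real n) * sqrt (real n) ^ n) * ennreal ((x + y) ^ n)" .
  qed
  also have "\<dots> = ennreal (lam * unit_ball_vol (real n) * sqrt (real n) ^ n) *
    (\<integral>\<^sup>+x. \<integral>\<^sup>+y. ennreal ((x + y) ^ n) \<partial>Q \<partial>Q)"
    by (subst nn_integral_cmult[symmetric], measurable, intro nn_integral_cong nn_integral_cmult) measurable
  finally show ?thesis .
qed

section \<open>Volume of balls in high dimension\<close>

lemma ln_Gamma_plus_one:
  assumes "0 < x"
  shows "ln_Gamma (x + 1 :: real) = ln x + ln_Gamma x"
proof -
  have "x \<notin> \<int>\<^sub>\<le>\<^sub>0" using assms nonpos_Ints_nonpos[of x] by auto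
  then have "exp (ln_Gamma (x + 1)) = exp (ln x + ln_Gamma x)"
    using assms Gamma_real_pos_exp[of x] Gamma_real_pos_exp[of "x + 1"] Gamma_plus1[of x]
    by (simp add: exp_add)
  then show ?thesis by simp
qed

text \<open>Crude Stirling bounds: each side, as a function of \<open>x\<close>, moves under \<open>x \<mapsto> x + 1\<close> by no more
  (resp. no less) than \<open>ln (x + 1)\<close>, so they propagate from \<open>x = 0\<close> and \<open>x = 1/2\<close>.\<close>

lemma ln_Gamma_half_integer_lower:
  "\<exists>c. \<forall>n. real n / 2 * ln (real n / 2) - real n / 2 - c \<le> ln_Gamma (real n / 2 + 1)"
proof -
  let ?l = "\<lambda>x::real. x * ln x - x"
  define c where "c = max (?l 0 - ln_Gamma 1) (?l (1/2) - ln_Gamma (3/2))"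
  have "?l (real n / 2) - c \<le> ln_Gamma (real n / 2 + 1)" for n
  \<comment> \<open>Adding 2 to \<open>n\<close> adds 1 to \<open>x = n / 2\<close>, so there are
    two bases, \<open>n = 0\<close> and \<open>n = 1\<close>; \<open>c\<close> is the larger of the
    defects there.\<close>
  proof (induction n rule: induct_nat_012)
    case (ge2 n)
    define x where "x = real n / 2"
    have x: "0 \<le> x" by (simp add: x_def)
    have e: "real (Suc (Suc n)) / 2 = x + 1" by (simp add: x_def)
    have "x * (ln (x + 1) - ln x) \<le> 1"
    proof (cases "x = 0")
      case False
      then have "0 < x" using x by simp
      then have "(x + 1) / x = 1 + 1 / x" by (simp add: field_simps)
      then have "ln (x + 1) - ln x = ln (1 + 1 / x)"
        using ln_div[of "x + 1" x] \<open>0 < x\<close> by simp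
      also have "\<dots> \<le> 1 / x" using \<open>0 < x\<close> by (intro ln_add_one_self_le_self) simp
      finally have "x * (ln (x + 1) - ln x) \<le> x * (1 / x)" using x by (rule mult_left_mono)
      then show ?thesis using \<open>0 < x\<close> by simp
    qed simp
    then have "?l (x + 1) \<le> ?l x + ln (x + 1)" by (simp add: algebra_simps)
    also have "\<dots> \<le> ln_Gamma (x + 1) + c + ln (x + 1)" using ge2(1) by (simp add: x_def)
    also have "\<dots> = ln_Gamma (x + 1 + 1) + c" using x by (subst (2) ln_Gamma_plus_one) auto
    finally show ?case unfolding e by simp
  qed (auto simp: c_def)
  then show ?thesis by blast
qed

lemma ln_Gamma_half_integer_upper:
  "\<exists>c. \<forall>n. ln_Gamma (real n / 2 + 1) \<le> (real n / 2 + 1) * ln (real n / 2 + 1) - real n / 2 + c"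
proof -
  let ?u = "\<lambda>x::real. (x + 1) * ln (x + 1) - x"
  define c where "c = max (ln_Gamma 1 - ?u 0) (ln_Gamma (3/2) - ?u (1/2))"
  have "ln_Gamma (real n / 2 + 1) \<le> ?u (real n / 2) + c" for n
  proof (induction n rule: induct_nat_012)
    case (ge2 n)
    define x where "x = real n / 2"
    have x: "0 \<le> x" by (simp add: x_def)
    have e: "real (Suc (Suc n)) / 2 = x + 1" by (simp add: x_def)
    have "ln (x + 1) - ln (x + 2) = ln ((x + 1) / (x + 2))"
      using x by (simp add: ln_div)
    also have "\<dots> \<le> (x + 1) / (x + 2) - 1"
      using x by (intro ln_le_minus_one) simp
    also have "\<dots> = - 1 / (x + 2)" using x by (simp add: field_simps)
    finally have "(x + 2) * (ln (x + 1) - ln (x + 2)) \<le> (x + 2) * (- 1 / (x + 2))"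
      using x by (intro mult_left_mono) auto
    then have *: "?u x + ln (x + 1) \<le> ?u (x + 1)" using x by (simp add: algebra_simps)
    have "ln_Gamma (x + 1 + 1) = ln_Gamma (x + 1) + ln (x + 1)" using x by (subst ln_Gamma_plus_one) auto
    also have "\<dots> \<le> ?u x + c + ln (x + 1)" using ge2(1) by (simp add: x_def)
    also have "\<dots> \<le> ?u (x + 1) + c" using * by simp
    finally show ?case unfolding e by simp
  qed (auto simp: c_def)
  then show ?thesis by blast
qed

text \<open>The factor \<open>sqrt n ^ n\<close> contributes \<open>ln n / 2\<close> per dimension,
  which cancels the divergent term of Stirling's formula for the Gamma function in the denominator.
  \<open>G\<close> is what remains, with limit \<open>- (1 + ln 2) / 2\<close>; the numerator
  contributes \<open>ln pi / 2\<close>.\<close>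

lemma ln_ball_volume_rate:
  "(\<lambda>n. ln (unit_ball_vol (real n) * sqrt (real n) ^ n) / real n) \<longlonglongrightarrow> 1 / 2 * ln (2 * pi * exp 1)"
proof -
  obtain c where c: "\<And>n. real n / 2 * ln (real n / 2) - real n / 2 - c \<le> ln_Gamma (real n / 2 + 1)"
    using ln_Gamma_half_integer_lower by blast
  obtain d where d: "\<And>n. ln_Gamma (real n / 2 + 1) \<le>
      (real n / 2 + 1) * ln (real n / 2 + 1) - real n / 2 + d"
    using ln_Gamma_half_integer_upper by blast
  define G where "G n = ln_Gamma (real n / 2 + 1) / real n - ln (real n) / 2" for n :: nat
  have "G \<longlonglongrightarrow> - (1 + ln 2) / 2"
  proof (rule tendsto_sandwich)
    show "\<forall>\<^sub>F n in sequentially. (real n / 2 * ln (real n / 2) - real n / 2 - c) / real n - ln (real n) / 2 \<le> G n"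
      using c by (auto simp: G_def intro!: always_eventually divide_right_mono)
    show "\<forall>\<^sub>F n in sequentially. G n \<le>
      ((real n / 2 + 1) * ln (real n / 2 + 1) - real n / 2 + d) / real n - ln (real n) / 2"
      using d by (auto simp: G_def intro!: always_eventually divide_right_mono)
    show "(\<lambda>n. (real n / 2 * ln (real n / 2) - real n / 2 - c) / real n - ln (real n) / 2)
        \<longlonglongrightarrow> - (1 + ln 2) / 2"
      by (real_asymp simp: ln_div field_simps)
    show "(\<lambda>n. ((real n / 2 + 1) * ln (real n / 2 + 1) - real n / 2 + d) / real n - ln (real n) / 2)
        \<longlonglongrightarrow> - (1 + ln 2) / 2"
      by (real_asymp simp: ln_div field_simps)
  qed
  then have "(\<lambda>n. 1 / 2 * ln pi - G n) \<longlonglongrightarrow> 1 / 2 * ln pi - - (1 + ln 2) / 2"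
    by (intro tendsto_intros)
  also have "1 / 2 * ln pi - - (1 + ln 2) / 2 = 1 / 2 * ln (2 * pi * exp 1)"
    by (simp add: ln_mult field_simps)
  finally show ?thesis
  proof (rule Lim_transform_eventually)
    show "\<forall>\<^sub>F n in sequentially. 1 / 2 * ln pi - G n =
      ln (unit_ball_vol (real n) * sqrt (real n) ^ n) / real n"
      using eventually_gt_at_top[of 0]
    proof eventually_elim
      case (elim n)
      have "Gamma (real n / 2 + 1) = exp (ln_Gamma (real n / 2 + 1))"
        by (intro Gamma_real_pos_exp) simp
      then have "ln (unit_ball_vol (real n)) = real n / 2 * ln pi - ln_Gamma (real n / 2 + 1)"
        by (simp add: unit_ball_vol_def ln_div ln_powr)
      moreover have "ln (sqrt (real n) ^ n) = real n * (ln (real n) / 2)"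
        using elim by (simp add: ln_realpow ln_sqrt)
      moreover have "ln (unit_ball_vol (real n) * sqrt (real n) ^ n) =
        ln (unit_ball_vol (real n)) + ln (sqrt (real n) ^ n)"
        using elim unit_ball_vol_pos[of "real n"] by (intro ln_mult_pos) auto
      ultimately have "ln (unit_ball_vol (real n) * sqrt (real n) ^ n) =
        real n / 2 * ln pi - ln_Gamma (real n / 2 + 1) + real n * (ln (real n) / 2)" by simp
      then show ?case using elim by (simp add: G_def diff_divide_distrib add_divide_distrib)
    qed
  qed
qed

section \<open>Exponential rates and large deviations\<close>

lemma elog_ennreal_rate:
  assumes "0 < n" "0 < x"
  shows "elog (ennreal x) / ereal (real n) = ereal (ln x / real n)"
  using assms by (simp add: elog_def)

text \<open>Moves statements about extended-real rates to inequalities between measures or moments,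
  which can be multiplied and integrated. The conventions of \<open>elog\<close> at 0 and at
  infinity make the equivalence hold without exceptions.\<close>

lemma elog_rate_le_iff:
  assumes n: "0 < n"
  shows "elog m / ereal (real n) \<le> ereal v \<longleftrightarrow> m \<le> ennreal (exp (real n * v))"
proof (cases m)
  case (real x)
  show ?thesis
  proof (cases "x = 0")
    case True
    then show ?thesis using real n by (simp add: elog_def)
  next
    case False
    then have x: "0 < x" using real by simp
    have "elog m / ereal (real n) \<le> ereal v \<longleftrightarrow> ln x \<le> real n * v"
      unfolding real(2) elog_ennreal_rate[OF n x] using n by (simp add: pos_divide_le_eq mult.commute)
    also have "\<dots> \<longleftrightarrow> x \<le> exp (real n * v)"
      using x by (subst (2) ln_le_cancel_iff[symmetric]) auto
    also have "\<dots> \<longleftrightarrow> m \<le> ennreal (exp (real n * v))"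
      unfolding real(2) by (rule ennreal_le_iff[symmetric]) simp
    finally show ?thesis .
  qed
next
  case top
  then show ?thesis using n by (simp add: elog_def top_unique)
qed

lemma elog_rate_ge_iff:
  assumes n: "0 < n"
  shows "ereal v \<le> elog m / ereal (real n) \<longleftrightarrow> ennreal (exp (real n * v)) \<le> m"
proof (cases m)
  case (real x)
  show ?thesis
  proof (cases "x = 0")
    case True
    then show ?thesis using real n by (simp add: elog_def ennreal_eq_0_iff)
  next
    case False
    then have x: "0 < x" using real by simp
    have "ereal v \<le> elog m / ereal (real n) \<longleftrightarrow> real n * v \<le> ln x"
      unfolding real(2) elog_ennreal_rate[OF n x] using n by (simp add: pos_le_divide_eq mult.commute)
    also have "\<dots> \<longleftrightarrow> exp (real n * v) \<le> x" using x by (subst ln_ge_iff) auto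
    also have "\<dots> \<longleftrightarrow> ennreal (exp (real n * v)) \<le> m"
      unfolding real(2) using x by (intro ennreal_le_iff[symmetric]) simp
    finally show ?thesis .
  qed
next
  case top
  then show ?thesis using n by (simp add: elog_def)
qed

lemma elog_rate_tendsto:
  assumes "\<And>e. 0 < e \<Longrightarrow> \<forall>\<^sub>F n in sequentially.
    ennreal (exp (real n * (v - e))) \<le> a n \<and> a n \<le> ennreal (exp (real n * (v + e)))"
  shows "(\<lambda>n. elog (a n) / ereal (real n)) \<longlonglongrightarrow> ereal v"
proof (rule order_tendstoI)
  fix y assume "y < ereal v"
  then obtain z where z: "y < ereal z" "z < v" using ereal_dense2 by (metis ereal_less(2) less_ereal.simps(1))
  show "\<forall>\<^sub>F n in sequentially. y < elog (a n) / ereal (real n)"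
    using assms[of "v - z", unfolded diff_gt_0_iff_gt, OF z(2)] eventually_gt_at_top[of 0]
  proof eventually_elim
    case (elim n)
    then have "ereal z \<le> elog (a n) / ereal (real n)"
      using elog_rate_ge_iff[of n z "a n"] by simp
    then show ?case by (rule less_le_trans[OF z(1)])
  qed
next
  fix y assume "ereal v < y"
  then obtain z where z: "ereal z < y" "v < z" using ereal_dense2 by (metis less_ereal.simps(1))
  show "\<forall>\<^sub>F n in sequentially. elog (a n) / ereal (real n) < y"
    using assms[of "z - v", unfolded diff_gt_0_iff_gt, OF z(2)] eventually_gt_at_top[of 0]
  proof eventually_elim
    case (elim n)
    then have "elog (a n) / ereal (real n) \<le> ereal z"
      using elog_rate_le_iff[of n "a n" z] by simp
    then show ?case by (rule le_less_trans[OF _ z(1)])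
  qed
qed

lemma tends_to_zero_exp_fast_imp_tendsto:
  assumes "tends_to_zero_exp_fast a"
  shows "a \<longlonglongrightarrow> 0"
proof -
  obtain c where c: "0 < c" "\<forall>\<^sub>F n in sequentially. a n \<le> ennreal (exp (- c * real n))"
    using assms by (auto simp: tends_to_zero_exp_fast_def)
  have "(\<lambda>n. ennreal (exp (- c * real n))) \<longlonglongrightarrow> ennreal 0"
    by (intro tendsto_ennrealI) (use c(1) in real_asymp)
  then show ?thesis
    using c(2) by (intro tendsto_sandwich[of "\<lambda>_. 0" a _ "\<lambda>n. ennreal (exp (- c * real n))"]) auto
qed

lemma tends_to_infinity_exp_fast_imp_tendsto:
  assumes "tends_to_infinity_exp_fast a"
  shows "a \<longlonglongrightarrow> \<top>"
proof -
  obtain c where c: "0 < c" "\<forall>\<^sub>F n in sequentially. ennreal (exp (c * real n)) \<le> a n"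
    using assms by (auto simp: tends_to_infinity_exp_fast_def)
  have "filterlim (\<lambda>n. exp (c * real n)) at_top sequentially" using c(1) by real_asymp
  then have "(\<lambda>n. ennreal (exp (c * real n))) \<longlonglongrightarrow> \<top>" by (simp add: ennreal_tendsto_top_eq_at_top)
  then show ?thesis
    using c(2) by (intro tendsto_sandwich[of "\<lambda>n. ennreal (exp (c * real n))" a _ "\<lambda>_. \<top>"]) auto
qed

text \<open>A finite lower bound \<open>u\<close> stands in for the infimum of \<open>I\<close> over
  \<open>F\<close>, which may be infinite; the slack \<open>e\<close> turns a limsup into an
  eventual bound.\<close>

lemma ldp_upper_bound:
  assumes ldp: "large_deviations_principle Q I" and F: "closed F"
    and u: "0 \<le> u" "\<And>x. x \<in> F \<Longrightarrow> ennreal u \<le> I x" and e: "0 < e"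
  shows "\<forall>\<^sub>F n in sequentially. emeasure (Q n) F \<le> ennreal (exp (real n * (e - u)))"
proof -
  have "ereal u \<le> (INF x\<in>F. enn2ereal (I x))"
  proof (rule INF_greatest)
    fix x assume "x \<in> F"
    then have "enn2ereal (ennreal u) \<le> enn2ereal (I x)"
      unfolding less_eq_ennreal.rep_eq[symmetric] by (rule u(2))
    then show "ereal u \<le> enn2ereal (I x)" using u(1) by (simp only: enn2ereal_ennreal)
  qed
  then have "- (INF x\<in>F. enn2ereal (I x)) \<le> - ereal u" by (simp only: ereal_minus_le_minus)
  also have "\<dots> < ereal (e - u)" using e by simp
  finally have "- (INF x\<in>F. enn2ereal (I x)) < ereal (e - u)" .
  moreover have "limsup (\<lambda>n. elog (emeasure (Q n) F) / ereal (real n)) \<le> - (INF x\<in>F. enn2ereal (I x))"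
    using ldp F unfolding large_deviations_principle_def by blast
  ultimately have "limsup (\<lambda>n. elog (emeasure (Q n) F) / ereal (real n)) < ereal (e - u)"
    by (rule le_less_trans[rotated])
  then have "\<forall>\<^sub>F n in sequentially. elog (emeasure (Q n) F) / ereal (real n) < ereal (e - u)"
    by (rule Limsup_lessD)
  then show ?thesis using eventually_gt_at_top[of 0]
  proof eventually_elim
    case (elim n)
    then show ?case using elog_rate_le_iff[of n "emeasure (Q n) F" "e - u"] by (simp only: less_imp_le)
  qed
qed

lemma ldp_lower_bound:
  assumes ldp: "large_deviations_principle Q I" and G: "open G" "x \<in> G"
    and u: "0 \<le> u" "I x = ennreal u" and e: "0 < e"
  shows "\<forall>\<^sub>F n in sequentially. ennreal (exp (- real n * (u + e))) \<le> emeasure (Q n) G"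
proof -
  have "(INF x\<in>G. enn2ereal (I x)) \<le> ereal u"
    by (rule INF_lower2[OF G(2)]) (use u in \<open>simp add: enn2ereal_ennreal\<close>)
  then have "- ereal u \<le> - (INF x\<in>G. enn2ereal (I x))" by (simp only: ereal_minus_le_minus)
  then have "ereal (- (u + e)) < - (INF x\<in>G. enn2ereal (I x))"
    by (rule less_le_trans[rotated]) (use e in simp)
  also have "\<dots> \<le> liminf (\<lambda>n. elog (emeasure (Q n) G) / ereal (real n))"
    using ldp G(1) unfolding large_deviations_principle_def by blast
  finally have "ereal (- (u + e)) < liminf (\<lambda>n. elog (emeasure (Q n) G) / ereal (real n))" .
  then have "\<forall>\<^sub>F n in sequentially. ereal (- (u + e)) < elog (emeasure (Q n) G) / ereal (real n)"
    by (rule less_LiminfD)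
  then show ?thesis using eventually_gt_at_top[of 0]
  proof eventually_elim
    case (elim n)
    then have "ennreal (exp (real n * - (u + e))) \<le> emeasure (Q n) G"
      using elog_rate_ge_iff[of n "- (u + e)" "emeasure (Q n) G"] by (simp only: less_imp_le)
    then show ?case by (simp only: mult_minus_right mult_minus_left)
  qed
qed

text \<open>Any finite number strictly above the limsup serves as \<open>C\<close>; being strictly
  above, it is also positive, as needed for the real powers defining the cutoffs
  \<open>K\<close>.\<close>

lemma eventually_moment_bound:
  assumes "limsup (\<lambda>n. eroot n (m n)) < \<top>"
  shows "\<exists>C>0. \<forall>\<^sub>F n in sequentially. m n \<le> ennreal (C ^ n)"
proof -
  obtain y where y: "limsup (\<lambda>n. eroot n (m n)) < y" "y < \<top>" using dense[OF assms] by blast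
  define C where "C = enn2real y"
  have yC: "y = ennreal C" using y by (simp add: C_def)
  have "0 < y" using y(1) by (rule le_less_trans[rotated]) simp
  then have "0 < C" by (simp add: yC)
  moreover have "\<forall>\<^sub>F n in sequentially. eroot n (m n) < y" by (rule Limsup_lessD) fact
  then have "\<forall>\<^sub>F n in sequentially. m n \<le> ennreal (C ^ n)"
    using eventually_gt_at_top[of 0]
  proof eventually_elim
    case (elim n)
    then have "m n \<noteq> \<top>" by (auto simp: eroot_def)
    then obtain x where x: "m n = ennreal x" "0 \<le> x" by (cases "m n") auto
    then have "root n x < C" using elim \<open>0 < C\<close>
      by (simp add: eroot_def yC ennreal_less_iff)
    then have "root n x ^ n \<le> C ^ n" using x elim by (intro power_mono) auto
    then show ?case using x elim by (simp add: ennreal_leI)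
  qed
  ultimately show ?thesis by blast
qed

text \<open>A pointwise Markov inequality, used with \<open>q = \<gamma> * n\<close>: the
  contribution of radii above \<open>K\<close> to a lower moment is bounded by the assumed
  one.\<close>

lemma powr_le_tail:
  fixes x :: real
  assumes "0 < K" "K \<le> x" "p \<le> q"
  shows "x powr p \<le> K powr (p - q) * x powr q"
proof -
  have "x powr p = x powr (p - q) * x powr q" by (simp add: powr_add[symmetric])
  also have "\<dots> \<le> K powr (p - q) * x powr q"
    using assms by (intro mult_right_mono powr_mono2') auto
  finally show ?thesis .
qed

section \<open>Radii with a convex rate function\<close>

text \<open>Collects what concerns the laws of the radii alone. Since no realisation of the process
  is fixed, the results apply to the given processes and to all those over which
  \<open>is_degree_threshold\<close> quantifies. Here \<open>c\<close> is R*.\<close>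

locale radius_laws =
  fixes Q :: "nat \<Rightarrow> real measure" and I :: "real \<Rightarrow> ennreal" and c \<gamma> C :: real
  assumes sets_Q[measurable_cong]: "\<And>n. sets (Q n) = sets borel"
    and prob_Q: "\<And>n. 1 \<le> n \<Longrightarrow> prob_space (Q n)"
    and nonneg_Q: "\<And>n. 1 \<le> n \<Longrightarrow> AE x in Q n. 0 \<le> x"
    and ldp: "large_deviations_principle Q I"
    and good: "good_rate_function I"
    and conv: "convex_rate_function I"
    and c_pos: "0 < c"
    and mean: "(\<lambda>n. \<integral>\<^sup>+x. ennreal x \<partial>Q n) \<longlonglongrightarrow> ennreal c"
    and gamma: "1 < \<gamma>"
    and C_pos: "0 < C"
    and moment: "\<forall>\<^sub>F n in sequentially. (\<integral>\<^sup>+x. ennreal (x powr (\<gamma> * real n)) \<partial>Q n) \<le> ennreal (C ^ n)"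
begin

section \<open>Shape of the rate function\<close>

lemma convexD: "0 \<le> t \<Longrightarrow> t \<le> 1 \<Longrightarrow> I ((1 - t) * x + t * y) \<le> ennreal (1 - t) * I x + ennreal t * I y"
  using conv by (auto simp: convex_rate_function_def)

lemma rate_between_le:
  assumes "x \<le> z" "z \<le> y" "I x \<le> e" "I y \<le> e"
  shows "I z \<le> e"
proof (cases "x = y")
  case False
  define t where "t = (z - x) / (y - x)"
  have t: "0 \<le> t" "t \<le> 1" and z: "z = (1 - t) * x + t * y"
  proof -
    have "t * (y - x) = z - x" using assms False by (simp add: t_def)
    then show "z = (1 - t) * x + t * y" by (simp add: algebra_simps)
  qed (use assms False in \<open>auto simp: t_def field_simps\<close>)
  have "I z \<le> ennreal (1 - t) * I x + ennreal t * I y" unfolding z by (rule convexD[OF t])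
  also have "\<dots> \<le> ennreal (1 - t) * e + ennreal t * e"
    using assms by (intro add_mono mult_left_mono) auto
  also have "\<dots> = (ennreal (1 - t) + ennreal t) * e" by (simp add: distrib_right)
  also have "ennreal (1 - t) + ennreal t = 1" using t by (simp add: ennreal_plus[symmetric] del: ennreal_plus)
  finally show ?thesis by simp
qed (use assms in auto)

text \<open>If \<open>I c > 0\<close>, convexity leaves all of the mass strictly on one side of \<open>c\<close>; uniform
  integrability then keeps the means away from \<open>c\<close>.\<close>

lemma rate_at_mean: "I c = 0"
proof (rule ccontr)
  assume "I c \<noteq> 0"
  then have "0 < I c" by (simp add: zero_less_iff_neq_zero)
  then obtain e' where e': "0 < e'" "e' < I c" using dense by blast
  then obtain e where e: "e' = ennreal e" "0 < e"
    by (cases e') auto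
  have "I c \<le> Liminf (at c) I"
    using good by (simp add: good_rate_function_def lower_semicontinuous_def)
  then have "\<forall>\<^sub>F x in at c. ennreal e < I x" using e' e by (auto simp: le_Liminf_iff)
  then obtain d where d: "0 < d" "\<And>x. x \<noteq> c \<Longrightarrow> dist x c < d \<Longrightarrow> ennreal e < I x"
    unfolding eventually_at by auto
  \<comment> \<open>The first bound keeps the window around \<open>c\<close> inside the
    neighbourhood where \<open>I > e\<close>, the second keeps its left end positive.\<close>
  define \<eta> where "\<eta> = min (d / 2) (c / 2)"
  have \<eta>: "0 < \<eta>" "\<eta> < c" "\<eta> < d" using d c_pos by (auto simp: \<eta>_def)
  have near: "ennreal e < I x" if "\<bar>x - c\<bar> \<le> \<eta>" for x
    using d(2)[of x] e' e \<eta> that by (cases "x = c") (auto simp: dist_real_def)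
  \<comment> \<open>No point of the window has rate below \<open>e\<close>; one such point on each
    side would force \<open>I c <= e\<close>, sublevel sets being intervals.\<close>
  have "(\<forall>x\<le>c + \<eta>. ennreal e \<le> I x) \<or> (\<forall>x\<ge>c - \<eta>. ennreal e \<le> I x)"
  proof (rule ccontr)
    assume "\<not> ?thesis"
    then obtain x y where xy: "x \<le> c + \<eta>" "I x < ennreal e" "c - \<eta> \<le> y" "I y < ennreal e"
      by (auto simp: not_le)
    then have "x < c" "c < y" using near[of x] near[of y] by (force simp: abs_le_iff)+
    then have "I c \<le> ennreal e" using rate_between_le[of x c y] xy by auto
    then show False using e' e by simp
  qed
  then show False
  proof
    \<comment> \<open>All but exponentially little mass lies above \<open>c + \<eta>\<close>, so the
      limit of the means would be at least \<open>c + \<eta>\<close>.\<close>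
    assume low: "\<forall>x\<le>c + \<eta>. ennreal e \<le> I x"
    let ?b = "c + \<eta>"
    have "\<forall>\<^sub>F n in sequentially. emeasure (Q n) {..?b} \<le> ennreal (exp (real n * (e / 2 - e)))"
      by (rule ldp_upper_bound[OF ldp]) (use e low in auto)
    then have "\<forall>\<^sub>F n in sequentially. ennreal (?b * (1 - exp (real n * (e / 2 - e)))) \<le> (\<integral>\<^sup>+x. ennreal x \<partial>Q n)"
      using eventually_ge_at_top[of 1]
    proof eventually_elim
      case (elim n)
      interpret prob_space "Q n" using prob_Q elim by simp
      have "1 - exp (real n * (e / 2 - e)) \<le> 1 - prob {..?b}"
        using elim by (simp add: emeasure_eq_measure)
      also have "\<dots> = prob (space (Q n) - {..?b})" by (rule prob_compl[symmetric]) simp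
      also have "space (Q n) - {..?b} = {?b<..}" using sets_eq_imp_space_eq[OF sets_Q] by auto
      finally have "ennreal (?b * (1 - exp (real n * (e / 2 - e)))) \<le> ennreal (?b * prob {?b<..})"
        using c_pos \<eta> by (intro ennreal_leI mult_left_mono) auto
      also have "\<dots> = (\<integral>\<^sup>+x. ennreal ?b * indicator {?b<..} x \<partial>Q n)"
        using c_pos \<eta> by (simp add: nn_integral_cmult_indicator ennreal_mult emeasure_eq_measure)
      also have "\<dots> \<le> (\<integral>\<^sup>+x. ennreal x \<partial>Q n)"
        by (intro nn_integral_mono) (auto split: split_indicator intro: ennreal_leI)
      finally show ?case .
    qed
    moreover have "(\<lambda>n. ennreal (?b * (1 - exp (real n * (e / 2 - e))))) \<longlonglongrightarrow> ennreal ?b"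
      by (intro tendsto_ennrealI) (use \<open>0 < e\<close> in real_asymp)
    ultimately have "ennreal ?b \<le> ennreal c" using mean by (intro tendsto_le) auto
    then show False using \<eta> c_pos by simp
  next
    assume high: "\<forall>x\<ge>c - \<eta>. ennreal e \<le> I x"
    let ?b = "c - \<eta>"
    \<comment> \<open>Now all but exponentially little mass lies below \<open>c - \<eta>\<close>,
      but rare large radii could still raise the mean. As \<open>K powr \<gamma> = 2 * C\<close>,
      the moment bound limits the contribution of radii above \<open>K\<close> to
      \<open>K / 2 ^ n\<close>; radii between \<open>?b\<close> and \<open>K\<close> contribute at
      most \<open>K\<close> times a vanishing probability.\<close>
    define K where "K = (2 * C) powr (1 / \<gamma>)"
    have K: "0 < K" using C_pos by (simp add: K_def)
    have Kg: "K powr (1 - \<gamma> * real n) * C ^ n = K * (1 / 2) ^ n" for n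
    proof -
      have "K powr (\<gamma> * real n) = (2 * C) ^ n"
        using C_pos gamma by (simp add: K_def powr_powr powr_realpow)
      then show ?thesis using K C_pos by (simp add: powr_diff power_mult_distrib field_simps)
    qed
    have "\<forall>\<^sub>F n in sequentially. emeasure (Q n) {?b..} \<le> ennreal (exp (real n * (e / 2 - e)))"
      by (rule ldp_upper_bound[OF ldp]) (use e high in auto)
    then have "\<forall>\<^sub>F n in sequentially. (\<integral>\<^sup>+x. ennreal x \<partial>Q n) \<le>
      ennreal (?b + K * exp (real n * (e / 2 - e)) + K * (1 / 2) ^ n)"
      using eventually_ge_at_top[of 1] moment
    proof eventually_elim
      case (elim n)
      interpret prob_space "Q n" using prob_Q elim by simp
      have 1: "1 \<le> \<gamma> * real n" using gamma elim mult_mono[of 1 \<gamma> 1 "real n"] by simp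
      have "(\<integral>\<^sup>+x. ennreal x \<partial>Q n) \<le> (\<integral>\<^sup>+x. ennreal ?b + ennreal K * indicator {?b..} x +
        ennreal (K powr (1 - \<gamma> * real n)) * ennreal (x powr (\<gamma> * real n)) \<partial>Q n)"
      proof (rule nn_integral_mono)
        fix x :: real
        consider "x \<le> ?b" | "?b \<le> x" "x \<le> K" | "K \<le> x" "?b \<le> x" by linarith
        then show "ennreal x \<le> ennreal ?b + ennreal K * indicator {?b..} x +
          ennreal (K powr (1 - \<gamma> * real n)) * ennreal (x powr (\<gamma> * real n))"
        proof cases
          case 3
          have "x = x powr 1" using K 3 by simp
          also have "\<dots> \<le> K powr (1 - \<gamma> * real n) * x powr (\<gamma> * real n)"
            by (rule powr_le_tail) (use K 3 1 in auto)
          finally have "ennreal x \<le> ennreal (K powr (1 - \<gamma> * real n)) * ennreal (x powr (\<gamma> * real n))"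
            by (simp add: ennreal_mult[symmetric] ennreal_leI)
          then show ?thesis by (simp add: add_increasing)
        next
          case 1
          then have "ennreal x \<le> ennreal ?b" by (rule ennreal_leI)
          then show ?thesis by (simp add: add_increasing2 add.assoc)
        next
          case 2
          then have "ennreal x \<le> ennreal K * indicator {?b..} x" by (simp add: ennreal_leI)
          then show ?thesis by (simp add: add_increasing add_increasing2)
        qed
      qed
      also have "\<dots> = ennreal ?b + ennreal K * emeasure (Q n) {?b..} +
        ennreal (K powr (1 - \<gamma> * real n)) * (\<integral>\<^sup>+x. ennreal (x powr (\<gamma> * real n)) \<partial>Q n)"
        by (simp add: nn_integral_add nn_integral_cmult emeasure_space_1)
      also have "\<dots> \<le> ennreal ?b + ennreal K * ennreal (exp (real n * (e / 2 - e))) +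
        ennreal (K powr (1 - \<gamma> * real n)) * ennreal (C ^ n)"
        using elim by (intro add_mono mult_left_mono) auto
      also have "\<dots> = ennreal (?b + K * exp (real n * (e / 2 - e)) + K powr (1 - \<gamma> * real n) * C ^ n)"
        using \<eta> K C_pos by (simp add: ennreal_mult)
      finally show ?case unfolding Kg .
    qed
    moreover have "(\<lambda>n. exp (real n * (e / 2 - e))) \<longlonglongrightarrow> 0" using \<open>0 < e\<close> by real_asymp
    then have "(\<lambda>n. ennreal (?b + K * exp (real n * (e / 2 - e)) + K * (1 / 2) ^ n)) \<longlonglongrightarrow>
      ennreal (?b + K * 0 + K * 0)"
      by (intro tendsto_ennrealI tendsto_add tendsto_mult tendsto_const LIMSEQ_power_zero) auto
    ultimately have "ennreal c \<le> ennreal (?b + K * 0 + K * 0)"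
      using mean by (intro tendsto_le) auto
    then show False using \<eta> c_pos by simp
  qed
qed

lemma rate_mono:
  assumes "c \<le> x" "x \<le> y"
  shows "I x \<le> I y"
  using rate_between_le[OF assms, of "I y"] rate_at_mean by simp

text \<open>Compactness of the sublevel set at level 1 gives some \<open>b > c\<close> with
  \<open>I b >= 1\<close>. Beyond \<open>b\<close>, convexity keeps \<open>I\<close> above the line
  through \<open>(c, 0)\<close> and \<open>(b, 1)\<close>; to the left of \<open>b\<close> the bound
  is truncated to 0. The growth serves to beat the logarithm in the threshold.\<close>

lemma rate_linear_growth: "\<exists>b d. 0 < d \<and> (\<forall>x. ennreal ((x - b) / d) \<le> I x)"
proof -
  have "bounded {x. I x \<le> ennreal 1}"
    using good unfolding good_rate_function_def by (intro compact_imp_bounded) blast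
  then obtain B where B: "\<And>x. I x \<le> 1 \<Longrightarrow> \<bar>x\<bar> \<le> B" by (auto simp: bounded_iff)
  define b where "b = max B c + 1"
  have b: "c < b" and Ib: "1 \<le> I b"
    using B[of b] linear[of "I b" 1] by (auto simp: b_def)
  have "ennreal ((x - b) / (b - c)) \<le> I x" for x
  proof (cases "b < x")
    case True
    define t where "t = (b - c) / (x - c)"
    have t: "0 < t" "t \<le> 1" using True b by (auto simp: t_def)
    have "t * (x - c) = b - c" using True b by (simp add: t_def)
    then have "b = (1 - t) * c + t * x" by (simp add: algebra_simps)
    then have "I b \<le> ennreal t * I x" using convexD[of t c x] t rate_at_mean by simp
    then have "1 \<le> ennreal t * I x" using Ib by (rule order.trans[rotated])
    then have "ennreal (1 / t) * 1 \<le> ennreal (1 / t) * (ennreal t * I x)" by (rule mult_left_mono) simp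
    also have "\<dots> = I x" using t by (simp add: mult.assoc[symmetric] ennreal_mult[symmetric])
    finally have "ennreal (1 / t) \<le> I x" by simp
    moreover have "(x - b) / (b - c) \<le> 1 / t" using b True by (simp add: t_def divide_right_mono)
    ultimately show ?thesis using ennreal_leI order.trans by blast
  next
    case False
    then have "(x - b) / (b - c) \<le> 0" using b by (simp add: divide_nonpos_pos)
    then show ?thesis by (simp add: ennreal_neg)
  qed
  then show ?thesis using b by (intro exI[of _ b] exI[of _ "b - c"]) auto
qed

text \<open>\<open>I (max a c)\<close> is the infimum of \<open>I\<close> over \<open>{a..}\<close>,
  a nondecreasing convex function of \<open>a\<close>. Its midpoint convexity is what reduces pairs
  of radii to equal ones.\<close>

lemma rate_midpoint: "2 * I (max ((a + b) / 2) c) \<le> I (max a c) + I (max b c)"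
proof -
  let ?m = "(max a c + max b c) / 2"
  have "I (max ((a + b) / 2) c) \<le> I ?m" by (rule rate_mono) (auto simp: max_def)
  also have "\<dots> \<le> ennreal (1 / 2) * I (max a c) + ennreal (1 / 2) * I (max b c)"
    using convexD[of "1 / 2" "max a c" "max b c"] by (simp add: field_simps)
  finally have "2 * I (max ((a + b) / 2) c) \<le> 2 * (ennreal (1 / 2) * I (max a c) + ennreal (1 / 2) * I (max b c))"
    by (rule mult_left_mono) simp
  also have "\<dots> = (ennreal 2 * ennreal (1 / 2)) * I (max a c) + (ennreal 2 * ennreal (1 / 2)) * I (max b c)"
    by (simp add: distrib_left mult.assoc)
  also have "ennreal 2 * ennreal (1 / 2) = 1" by (subst ennreal_mult[symmetric]) auto
  finally show ?thesis by simp
qed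

section \<open>Finiteness of the variational formula\<close>

definition "threshold = real_of_ereal (INF R\<in>{2 * c..}. 2 * enn2ereal (I (R / 2)) - ereal (ln R))"

lemma threshold: "ereal threshold = (INF R\<in>{2 * c..}. 2 * enn2ereal (I (R / 2)) - ereal (ln R))"
proof -
  let ?f = "\<lambda>R. 2 * enn2ereal (I (R / 2)) - ereal (ln R)"
  obtain b d where d: "0 < d" and growth: "\<And>x. ennreal ((x - b) / d) \<le> I x"
    using rate_linear_growth by blast
  \<comment> \<open>The tangent bound \<open>ln R <= R / d - 1 + ln d\<close> cancels the linear
    lower bound of \<open>2 * I (R / 2)\<close> and leaves this constant.\<close>
  have "ereal (1 - 2 * b / d - ln d) \<le> (INF R\<in>{2 * c..}. ?f R)"
  proof (rule INF_greatest)
    fix R assume "R \<in> {2 * c..}"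
    then have R: "0 < R" using c_pos by simp
    show "ereal (1 - 2 * b / d - ln d) \<le> ?f R"
    proof (cases "I (R / 2)")
      case (real u)
      have "(R / 2 - b) / d \<le> u" using growth[of "R / 2"] real by (simp add: ennreal_le_iff)
      moreover have "ln R \<le> R / d - 1 + ln d"
        using ln_le_minus_one[of "R / d"] R d by (simp add: ln_div)
      ultimately have "1 - 2 * b / d - ln d \<le> 2 * u - ln R" by (simp add: diff_divide_distrib)
      then show ?thesis using real by (simp add: enn2ereal_ennreal numeral_eq_ereal)
    qed (simp add: top_ennreal.rep_eq numeral_eq_ereal)
  qed
  moreover have "(INF R\<in>{2 * c..}. ?f R) \<le> ereal (- ln (2 * c))"
    by (rule INF_lower2[of "2 * c"]) (auto simp: rate_at_mean zero_ennreal.rep_eq)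
  ultimately show ?thesis
    unfolding threshold_def by (cases "INF R\<in>{2 * c..}. ?f R") auto
qed

lemma threshold_le:
  assumes "2 * c \<le> R" "I (R / 2) = ennreal u" "0 \<le> u"
  shows "threshold + ln R \<le> 2 * u"
proof -
  have "ereal threshold \<le> 2 * enn2ereal (I (R / 2)) - ereal (ln R)"
    unfolding threshold by (rule INF_lower) (use assms in auto)
  then show ?thesis using assms by (simp add: enn2ereal_ennreal numeral_eq_ereal)
qed

lemma threshold_approx:
  assumes "0 < e"
  obtains R u where "2 * c \<le> R" "I (R / 2) = ennreal u" "0 \<le> u" "2 * u - ln R < threshold + e"
proof -
  have "(INF R\<in>{2 * c..}. 2 * enn2ereal (I (R / 2)) - ereal (ln R)) < ereal (threshold + e)"
    unfolding threshold[symmetric] using assms by simp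
  then obtain R where R: "2 * c \<le> R" "2 * enn2ereal (I (R / 2)) - ereal (ln R) < ereal (threshold + e)"
    by (auto simp: INF_less_iff)
  then show thesis
    by (cases "I (R / 2)") (auto simp: enn2ereal_ennreal numeral_eq_ereal top_ennreal.rep_eq intro!: that[of R])
qed

section \<open>Exponential rate of the moment of two radii\<close>

definition "mean_power n = (\<integral>\<^sup>+x. \<integral>\<^sup>+y. ennreal ((x + y) ^ n) \<partial>Q n \<partial>Q n)"

text \<open>It suffices to keep the event that both radii exceed a level just below
  \<open>R / 2\<close>, for a nearly optimal \<open>R\<close>; by independence its probability is a
  square, whence the factor 2 in front of \<open>I\<close>.\<close>

lemma mean_power_lower:
  assumes e: "0 < e"
  shows "\<forall>\<^sub>F n in sequentially. ennreal (exp (real n * (- threshold - e))) \<le> mean_power n"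
proof -
  obtain R u where R: "2 * c \<le> R" and u: "I (R / 2) = ennreal u" "0 \<le> u"
    and approx: "2 * u - ln R < threshold + e / 2"
    using threshold_approx[of "e / 2"] e by auto
  have Rpos: "0 < R" using R c_pos by simp
  \<comment> \<open>Strictly below \<open>R / 2\<close>, so that the open half-line contains it. The
    losses are \<open>e / 2\<close> for the choice of \<open>R\<close>, \<open>e / 4\<close> here
    and \<open>e / 8\<close> for each of the two probabilities.\<close>
  define a where "a = R / 2 * exp (- e / 4)"
  have a: "0 < a" "a < R / 2" using Rpos e by (auto simp: a_def)
  have "\<forall>\<^sub>F n in sequentially. ennreal (exp (- real n * (u + e / 8))) \<le> emeasure (Q n) {a<..}"
    by (rule ldp_lower_bound[OF ldp, of _ "R / 2"]) (use a u e in auto)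
  then show ?thesis
  proof eventually_elim
    case (elim n)
    define q where "q = ennreal (exp (- real n * (u + e / 8)))"
    have "ln R - e / 4 - 2 * (u + e / 8) = ln R - 2 * u - e / 2" by simp
    then have "real n * (- threshold - e) \<le> real n * (ln R - e / 4 - 2 * (u + e / 8))"
      using approx by (intro mult_left_mono) auto
    then have "exp (real n * (- threshold - e)) \<le> exp (real n * (ln R - e / 4 - 2 * (u + e / 8)))" by simp
    also have "\<dots> = exp (real n * (ln R - e / 4)) * (exp (- real n * (u + e / 8)) * exp (- real n * (u + e / 8)))"
      unfolding exp_add[symmetric] by (simp add: algebra_simps)
    also have "exp (real n * (ln R - e / 4)) = (2 * a) ^ n"
    proof -
      have "exp (ln R - e / 4) = exp (ln R) * exp (- e / 4)" by (simp flip: exp_add)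
      also have "\<dots> = 2 * a" using Rpos by (simp add: a_def)
      finally show ?thesis by (simp only: exp_of_nat_mult)
    qed
    finally have "ennreal (exp (real n * (- threshold - e))) \<le> ennreal ((2 * a) ^ n) * (q * q)"
      using a unfolding q_def by (simp add: ennreal_mult[symmetric] ennreal_leI)
    also have "\<dots> \<le> ennreal ((2 * a) ^ n) * (emeasure (Q n) {a<..} * emeasure (Q n) {a<..})"
      using elim unfolding q_def by (intro mult_left_mono mult_mono) auto
    also have "\<dots> = (\<integral>\<^sup>+x. \<integral>\<^sup>+y. ennreal ((2 * a) ^ n) * indicator {a<..} x * indicator {a<..} y \<partial>Q n \<partial>Q n)"
      by (simp add: nn_integral_cmult nn_integral_multc mult_ac)
    also have "\<dots> \<le> mean_power n"
      unfolding mean_power_def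
    proof (intro nn_integral_mono)
      fix x y :: real
      have "ennreal ((2 * a) ^ n) \<le> ennreal ((x + y) ^ n)" if "a < x" "a < y"
        using a that by (intro ennreal_leI power_mono) auto
      then show "ennreal ((2 * a) ^ n) * indicator {a<..} x * indicator {a<..} y \<le> ennreal ((x + y) ^ n)"
        by (simp split: split_indicator)
    qed
    finally show ?case .
  qed
qed

text \<open>The radii below \<open>K\<close> are discretised: there \<open>(x + y) ^ n\<close> is at most \<open>exp (n (\<epsilon> - threshold))\<close> times
  \<open>h x * h y\<close>, where \<open>h\<close> is a sum of terms \<open>exp (n v)\<close> on half-lines \<open>{a..}\<close> of probability about
  \<open>exp (- n v)\<close>; the radii above \<open>K\<close> are negligible by the moment bound.\<close>

lemma mean_power_upper:
  assumes e: "0 < e"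
  shows "\<forall>\<^sub>F n in sequentially. mean_power n \<le> ennreal (exp (real n * (- threshold + e)))"
proof -
  define S where "S = - threshold"
  \<comment> \<open>Solves \<open>2 * K powr (1 - \<gamma>) * C = exp S\<close>: the moment bound
    for radii above \<open>K\<close> then has exactly the expected rate \<open>S\<close>.\<close>
  define K where "K = (2 * C * exp (- S)) powr (1 / (\<gamma> - 1))"
  have K: "0 < K" using C_pos by (simp add: K_def)
  have tail: "2 ^ n * K powr (real n - \<gamma> * real n) * C ^ n = exp (real n * S)" for n
  proof -
    define Z where "Z = 2 * C * exp (- S)"
    have Z: "0 < Z" using C_pos by (simp add: Z_def)
    have "1 / (\<gamma> - 1) * (real n - \<gamma> * real n) = - real n" using gamma by (simp add: field_simps)
    then have "K powr (real n - \<gamma> * real n) = Z powr (- real n)"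
      by (simp only: K_def powr_powr Z_def)
    also have "\<dots> = inverse (Z ^ n)" using Z by (simp add: powr_minus powr_realpow)
    finally have KZ: "K powr (real n - \<gamma> * real n) = inverse (Z ^ n)" .
    have "exp S * Z = 2 * C" by (simp add: Z_def exp_minus)
    then have "exp S ^ n * Z ^ n = 2 ^ n * C ^ n" by (simp only: power_mult_distrib[symmetric])
    then have "exp (real n * S) * Z ^ n = 2 ^ n * C ^ n" by (simp only: exp_of_nat_mult)
    then have "2 ^ n * C ^ n * inverse (Z ^ n) = exp (real n * S) * (Z ^ n * inverse (Z ^ n))"
      by (simp only: mult.assoc[symmetric])
    then show ?thesis unfolding KZ using Z by (simp add: mult_ac)
  qed
  \<comment> \<open>Mesh of the grid. Rounding both radii up adds at most
    \<open>2 * \<delta>\<close> to their sum; for sums of at least \<open>2 * c\<close> this changes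
    the logarithm by at most \<open>\<delta> / c = e / 4\<close>.\<close>
  define \<delta> where "\<delta> = c * e / 4"
  have \<delta>: "0 < \<delta>" using c_pos e by (simp add: \<delta>_def)
  \<comment> \<open>A cap that keeps the rates \<open>v\<close> finite. Since
    \<open>L + S >= ln (2 * K + 2 * \<delta>)\<close>, one capped rate alone pays for any two radii
    below \<open>K\<close>.\<close>
  define L where "L = max 0 (ln (2 * K + 2 * \<delta>) - S)"
  have L0: "0 \<le> L" by (simp add: L_def)
  define m where "m = nat \<lceil>K / \<delta>\<rceil>"
  define a where "a i = \<delta> * real i" for i
  define v where "v i = enn2real (min (I (max (a i) c)) (ennreal L))" for i
  have v: "ennreal (v i) = min (I (max (a i) c)) (ennreal L)" "0 \<le> v i" for i
    unfolding v_def by (subst ennreal_enn2real) (auto simp: min_less_iff_disj)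
  have ln_add: "ln (R + 2 * \<delta>) \<le> ln R + e / 4" if "2 * c \<le> R" for R
  proof -
    have R: "0 < R" using that c_pos by simp
    have "R + 2 * \<delta> = R * (1 + 2 * \<delta> / R)" using R by (simp add: distrib_left)
    then have "ln (R + 2 * \<delta>) = ln R + ln (1 + 2 * \<delta> / R)"
      using R \<delta> by (simp only:) (intro ln_mult_pos, auto intro!: add_pos_pos)
    also have "ln (1 + 2 * \<delta> / R) \<le> 2 * \<delta> / R" using R \<delta> by (intro ln_add_one_self_le_self) auto
    also have "\<dots> \<le> 2 * \<delta> / (2 * c)" using that c_pos \<delta> by (intro divide_left_mono) auto
    also have "\<dots> = e / 4" using c_pos by (simp add: \<delta>_def)
    finally show ?thesis by simp
  qed
  \<comment> \<open>The variational bound on the grid. A sum below \<open>2 * c\<close> is compared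
    with \<open>R = 2 * c\<close>, where the rate is 0; a capped rate suffices by the choice of
    \<open>L\<close>; otherwise \<open>rate_midpoint\<close> passes to
    \<open>R = a i + a j\<close>.\<close>
  have key: "ln (a i + a j + 2 * \<delta>) \<le> S + e / 4 + v i + v j" if "a i < K" "a j < K" for i j
  proof -
    have a0: "0 \<le> a i" "0 \<le> a j" using \<delta> by (auto simp: a_def)
    have ln_mono': "ln (a i + a j + 2 * \<delta>) \<le> ln b" if "a i + a j + 2 * \<delta> \<le> b" for b
      using that a0 \<delta> by (intro ln_mono) auto
    consider "a i + a j \<le> 2 * c" | "ennreal L < I (max (a i) c)" | "ennreal L < I (max (a j) c)"
      | "2 * c \<le> a i + a j" "I (max (a i) c) \<le> ennreal L" "I (max (a j) c) \<le> ennreal L"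
      by fastforce
    then show ?thesis
    proof cases
      case 1
      have "threshold + ln (2 * c) \<le> 2 * 0" by (rule threshold_le) (auto simp: rate_at_mean)
      then show ?thesis using ln_mono'[of "2 * c + 2 * \<delta>"] ln_add[of "2 * c"] 1 v(2)[of i] v(2)[of j]
        by (simp add: S_def)
    next
      case 2
      then have "v i = L" using L0 by (simp add: v_def min_absorb2)
      then show ?thesis using ln_mono'[of "2 * K + 2 * \<delta>"] that v(2)[of j] e by (simp add: L_def)
    next
      case 3
      then have "v j = L" using L0 by (simp add: v_def min_absorb2)
      then show ?thesis using ln_mono'[of "2 * K + 2 * \<delta>"] that v(2)[of i] e by (simp add: L_def)
    next
      case 4
      then have vI: "I (max (a i) c) = ennreal (v i)" "I (max (a j) c) = ennreal (v j)" by (auto simp: v)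
      have "max ((a i + a j) / 2) c = (a i + a j) / 2" using 4 by simp
      then have mid: "2 * I ((a i + a j) / 2) \<le> ennreal (v i + v j)"
        using rate_midpoint[of "a i" "a j"] v(2) by (simp add: vI)
      then have "I ((a i + a j) / 2) \<noteq> \<top>" by (auto simp: ennreal_mult_top top_unique)
      then obtain u where u: "I ((a i + a j) / 2) = ennreal u" "0 \<le> u" by (cases "I ((a i + a j) / 2)") auto
      have "ennreal (2 * u) \<le> ennreal (v i + v j)" using mid u by (simp add: ennreal_mult)
      then have "2 * u \<le> v i + v j" using v(2)[of i] v(2)[of j] by (subst (asm) ennreal_le_iff) auto
      then show ?thesis using threshold_le[OF 4(1) u] ln_add[OF 4(1)] by (simp add: S_def)
    qed
  qed
  define h :: "nat \<Rightarrow> real \<Rightarrow> ennreal" where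
    "h n x = (\<Sum>i<m. ennreal (exp (real n * v i)) * indicator {a i..} x)" for n x
  have h[measurable]: "h n \<in> borel_measurable borel" for n unfolding h_def by measurable
  have small: "ennreal ((x + y) ^ n) \<le> ennreal (exp (real n * (S + e / 4))) * (h n x * h n y)"
    if xy: "0 \<le> x" "x < K" "0 \<le> y" "y < K" for n x y
  proof -
    have cell: "\<exists>i<m. a i \<le> x \<and> x < a i + \<delta>" if x: "0 \<le> x" "x < K" for x
    proof -
      define q where "q = x / \<delta>"
      have x_eq: "x = \<delta> * q" and "0 \<le> q" using x \<delta> by (auto simp: q_def)
      then have i: "real (nat \<lfloor>q\<rfloor>) = of_int \<lfloor>q\<rfloor>" by simp
      have "q < K / \<delta>" using x \<delta> unfolding q_def by (intro divide_strict_right_mono)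
      then have "\<lfloor>q\<rfloor> < \<lceil>K / \<delta>\<rceil>" by linarith
      then have "nat \<lfloor>q\<rfloor> < m" using \<open>0 \<le> q\<close> K \<delta> by (simp add: m_def nat_less_iff)
      moreover have "a (nat \<lfloor>q\<rfloor>) \<le> x"
        unfolding a_def i x_eq using \<delta> by (intro mult_left_mono of_int_floor_le) auto
      moreover have "\<delta> * q < \<delta> * (of_int \<lfloor>q\<rfloor> + 1)"
        using \<delta> floor_correct[of q] by (intro mult_strict_left_mono) auto
      then have "x < a (nat \<lfloor>q\<rfloor>) + \<delta>" unfolding a_def i x_eq by (simp only: distrib_left mult_1_right)
      ultimately show ?thesis by blast
    qed
    have hge: "ennreal (exp (real n * v i)) \<le> h n x" if "i < m" "a i \<le> x" for i x
    proof -
      have "ennreal (exp (real n * v i)) = ennreal (exp (real n * v i)) * indicator {a i..} x" using that by simp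
      also have "\<dots> \<le> h n x" unfolding h_def using that by (intro member_le_sum) auto
      finally show ?thesis .
    qed
    obtain i j where i: "i < m" "a i \<le> x" "x < a i + \<delta>" and j: "j < m" "a j \<le> y" "y < a j + \<delta>"
      using cell xy by blast
    have a0: "0 \<le> a i" "0 \<le> a j" using \<delta> by (auto simp: a_def)
    have "(x + y) ^ n \<le> (a i + a j + 2 * \<delta>) ^ n" using xy i j by (intro power_mono) auto
    also have "\<dots> = exp (real n * ln (a i + a j + 2 * \<delta>))" unfolding exp_of_nat_mult using a0 \<delta> by simp
    also have "\<dots> \<le> exp (real n * (S + e / 4 + v i + v j))"
      using key[of i j] i j xy by (simp add: mult_left_mono)
    also have "\<dots> = exp (real n * (S + e / 4)) * (exp (real n * v i) * exp (real n * v j))"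
      unfolding exp_add[symmetric] by (simp add: algebra_simps)
    finally have "ennreal ((x + y) ^ n) \<le> ennreal (exp (real n * (S + e / 4))) *
      (ennreal (exp (real n * v i)) * ennreal (exp (real n * v j)))"
      by (simp only: ennreal_mult'[OF exp_ge_zero, symmetric] ennreal_leI)
    also have "\<dots> \<le> ennreal (exp (real n * (S + e / 4))) * (h n x * h n y)"
      using i j by (intro mult_left_mono mult_mono hge) auto
    finally show ?thesis .
  qed
  \<comment> \<open>The larger radius dominates: \<open>x + y <= 2 * x\<close>, which is where the 2
    in \<open>K\<close> comes from.\<close>
  have large: "ennreal ((x + y) ^ n) \<le> ennreal (2 ^ n * K powr (real n - \<gamma> * real n)) * ennreal (x powr (\<gamma> * real n))"
    if xy: "0 \<le> y" "y \<le> x" "K \<le> x" for n x y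
  proof -
    have x: "0 < x" using xy K by linarith
    have "1 * real n \<le> \<gamma> * real n" by (rule mult_right_mono) (use gamma in auto)
    have "(x + y) ^ n \<le> (2 * x) ^ n" using xy x by (intro power_mono) auto
    also have "\<dots> = 2 ^ n * x powr real n" using x by (simp add: power_mult_distrib powr_realpow)
    also have "\<dots> \<le> 2 ^ n * (K powr (real n - \<gamma> * real n) * x powr (\<gamma> * real n))"
      using K xy \<open>1 * real n \<le> \<gamma> * real n\<close> by (intro mult_left_mono powr_le_tail) auto
    finally have "(x + y) ^ n \<le> 2 ^ n * K powr (real n - \<gamma> * real n) * x powr (\<gamma> * real n)"
      by (simp only: mult.assoc)
    then show ?thesis by (subst ennreal_mult[symmetric]) (auto intro: ennreal_leI)
  qed
  define B where "B n = ennreal (2 ^ n * K powr (real n - \<gamma> * real n))" for n :: nat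
  define A where "A n = ennreal (exp (real n * (S + e / 4)))" for n :: nat
  let ?p = "\<lambda>n x. ennreal (x powr (\<gamma> * real n))"
  have pointwise: "ennreal ((x + y) ^ n) \<le> A n * (h n x * h n y) + B n * (?p n x + ?p n y)"
    if xy: "0 \<le> x" "0 \<le> y" for n x y
  proof -
    consider "x < K" "y < K" | "y \<le> x" "K \<le> x" | "x \<le> y" "K \<le> y" by linarith
    then show ?thesis
    proof cases
      case 1
      then show ?thesis using small[of x y n] xy by (simp add: A_def add_increasing2)
    next
      case 2
      then have "ennreal ((x + y) ^ n) \<le> B n * ?p n x" using large[of y x n] xy by (simp add: B_def)
      then show ?thesis by (simp add: distrib_left add_increasing add_increasing2)
    next
      case 3
      then have "ennreal ((x + y) ^ n) \<le> B n * ?p n y" using large[of x y n] xy by (simp add: B_def add.commute)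
      then show ?thesis by (simp add: distrib_left add_increasing add_increasing2)
    qed
  qed
  have "\<forall>\<^sub>F n in sequentially. emeasure (Q n) {a i..} \<le> ennreal (exp (real n * (e / 4 - v i)))" for i
  proof (rule ldp_upper_bound[OF ldp])
    fix x assume x: "x \<in> {a i..}"
    have "ennreal (v i) \<le> I (max (a i) c)" by (simp add: v)
    also have "\<dots> \<le> I x"
      using x rate_mono[of "a i" x] by (cases "a i \<le> c") (auto simp: rate_at_mean)
    finally show "ennreal (v i) \<le> I x" .
  qed (use v e in auto)
  then have "\<forall>\<^sub>F n in sequentially. \<forall>i<m. emeasure (Q n) {a i..} \<le> ennreal (exp (real n * (e / 4 - v i)))"
    by (auto intro!: eventually_ball_finite[of "{..<m}", simplified Ball_def lessThan_iff])
  \<comment> \<open>There are \<open>m ^ 2\<close> pairs of half-lines and two tails, one for each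
    radius. Absorbing their number takes the last quarter of \<open>e\<close>, after one for
    \<open>key\<close> and two for the probabilities.\<close>
  moreover have "\<forall>\<^sub>F n in sequentially. real m ^ 2 + 2 \<le> exp (real n * (e / 4))"
    using e by real_asymp
  ultimately show ?thesis using moment eventually_ge_at_top[of 1]
  proof eventually_elim
    case (elim n)
    interpret prob_space "Q n" using prob_Q elim by simp
    let ?M = "\<integral>\<^sup>+x. ?p n x \<partial>Q n"
    have hQ: "(\<integral>\<^sup>+x. h n x \<partial>Q n) \<le> ennreal (real m * exp (real n * (e / 4)))"
    proof -
      have "(\<integral>\<^sup>+x. h n x \<partial>Q n) = (\<Sum>i<m. ennreal (exp (real n * v i)) * emeasure (Q n) {a i..})"
        unfolding h_def by (subst nn_integral_sum) (auto simp: nn_integral_cmult)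
      also have "\<dots> \<le> (\<Sum>i<m. ennreal (exp (real n * v i)) * ennreal (exp (real n * (e / 4 - v i))))"
        using elim by (intro sum_mono mult_left_mono) auto
      also have "\<dots> = (\<Sum>i<m. ennreal (exp (real n * (e / 4))))"
        unfolding ennreal_mult[OF exp_ge_zero exp_ge_zero, symmetric] exp_add[symmetric]
        by (simp add: algebra_simps)
      also have "\<dots> = ennreal (real m * exp (real n * (e / 4)))"
        by (simp add: ennreal_mult ennreal_of_nat_eq_real_of_nat)
      finally show ?thesis .
    qed
    have "mean_power n \<le> (\<integral>\<^sup>+x. \<integral>\<^sup>+y. A n * (h n x * h n y) + B n * (?p n x + ?p n y) \<partial>Q n \<partial>Q n)"
      unfolding mean_power_def using nonneg_Q[OF elim(4)]
      by (intro nn_integral_mono_AE, eventually_elim, intro nn_integral_mono_AE, use nonneg_Q[OF elim(4)] in eventually_elim)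
         (rule pointwise)
    also have "\<dots> = A n * ((\<integral>\<^sup>+x. h n x \<partial>Q n) * (\<integral>\<^sup>+x. h n x \<partial>Q n)) + B n * (2 * ?M)"
      by (simp add: mult_2 nn_integral_add nn_integral_cmult nn_integral_multc emeasure_space_1)
    also have "\<dots> \<le> A n * (ennreal (real m * exp (real n * (e / 4))) * ennreal (real m * exp (real n * (e / 4)))) +
      B n * (2 * ennreal (C ^ n))"
      using hQ elim by (intro add_mono mult_left_mono mult_mono) auto
    also have "\<dots> = ennreal (exp (real n * (S + e / 4)) * (real m * exp (real n * (e / 4)) * (real m * exp (real n * (e / 4)))) +
      2 ^ n * K powr (real n - \<gamma> * real n) * (2 * C ^ n))"
      using C_pos by (simp add: A_def B_def ennreal_mult)
    also have "\<dots> = ennreal (real m ^ 2 * exp (real n * (S + 3 * e / 4)) + 2 * exp (real n * S))"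
    proof -
      have "exp (real n * (S + e / 4)) * (exp (real n * (e / 4)) * exp (real n * (e / 4))) = exp (real n * (S + 3 * e / 4))"
        unfolding exp_add[symmetric] by (simp add: algebra_simps)
      then show ?thesis using tail[of n] by (simp add: power2_eq_square distrib_left mult_ac)
    qed
    also have "\<dots> \<le> ennreal ((real m ^ 2 + 2) * exp (real n * (S + 3 * e / 4)))"
      using e by (intro ennreal_leI) (simp add: distrib_right mult_left_mono)
    also have "\<dots> \<le> ennreal (exp (real n * (e / 4)) * exp (real n * (S + 3 * e / 4)))"
      using elim by (intro ennreal_leI mult_right_mono) auto
    also have "exp (real n * (e / 4)) * exp (real n * (S + 3 * e / 4)) = exp (real n * (- threshold + e))"
      unfolding exp_add[symmetric] by (simp add: S_def algebra_simps)
    finally show ?case .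
  qed
qed

section \<open>From the moment to the mean degree\<close>

definition "degree_threshold = - (1 / 2) * ln (2 * pi * exp 1) + threshold"

text \<open>Half of \<open>e\<close> is spent on intensity and volume, whose joint rate converges to
  \<open>\<kappa>\<close>, and half on the moment. The sample space type is free, so the bounds
  serve both the theorem's processes and the type \<open>palm_sample\<close>.\<close>

lemma palm_mean_degree_bounds:
  fixes M :: "nat \<Rightarrow> 'a measure"
  assumes intensity: "r \<longlonglongrightarrow> \<rho>"
    and process: "\<And>n. 1 \<le> n \<Longrightarrow>
      palm_marked_poisson_process (M n) n (exp (real n * r n)) (Q n) (T n) (X n) (X0 n)"
    and e: "0 < e"
  shows "\<forall>\<^sub>F n in sequentially.
    ennreal (exp (real n * (\<rho> - degree_threshold - e))) \<le> palm_mean_degree (M n) n (T n) (X n) (X0 n) \<and>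
    palm_mean_degree (M n) n (T n) (X n) (X0 n) \<le> ennreal (exp (real n * (\<rho> - degree_threshold + e)))"
proof -
  define b where "b n = unit_ball_vol (real n) * sqrt (real n) ^ n" for n
  define \<kappa> where "\<kappa> = \<rho> + 1 / 2 * ln (2 * pi * exp 1)"
  have "(\<lambda>n. r n + ln (b n) / real n) \<longlonglongrightarrow> \<kappa>"
    unfolding \<kappa>_def b_def by (intro tendsto_add intensity ln_ball_volume_rate)
  then have "\<forall>\<^sub>F n in sequentially. \<kappa> - e / 2 < r n + ln (b n) / real n"
    "\<forall>\<^sub>F n in sequentially. r n + ln (b n) / real n < \<kappa> + e / 2"
    using e by (auto elim!: order_tendstoD)
  moreover have "0 < e / 2" using e by simp
  note mean_power_lower[OF this] mean_power_upper[OF this]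
  ultimately show ?thesis using eventually_ge_at_top[of 1]
  proof eventually_elim
    case (elim n)
    interpret palm_marked_poisson_process "M n" n "exp (real n * r n)" "Q n" "T n" "X n" "X0 n"
      using process elim by simp
    define \<beta> where "\<beta> = r n + ln (b n) / real n"
    have "0 < b n" using elim by (simp add: b_def)
    then have "exp (real n * \<beta>) = exp (real n * r n) * b n"
      using elim by (simp add: \<beta>_def distrib_left exp_add)
    then have ED: "palm_mean_degree (M n) n (T n) (X n) (X0 n) = ennreal (exp (real n * \<beta>)) * mean_power n"
      using palm_mean_degree_eq[OF elim(5) _ nonneg_Q[OF elim(5)]]
      by (simp add: mean_power_def b_def mult.assoc)
    have "\<rho> - degree_threshold - e \<le> \<beta> + (- threshold - e / 2)"
      "\<beta> + (- threshold + e / 2) \<le> \<rho> - degree_threshold + e"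
      using elim by (auto simp: \<beta>_def degree_threshold_def \<kappa>_def)
    then have exps: "exp (real n * (\<rho> - degree_threshold - e)) \<le> exp (real n * \<beta>) * exp (real n * (- threshold - e / 2))"
      "exp (real n * \<beta>) * exp (real n * (- threshold + e / 2)) \<le> exp (real n * (\<rho> - degree_threshold + e))"
      unfolding exp_add[symmetric] distrib_left[symmetric] by (auto intro!: mult_left_mono)
    show ?case
    proof
      have "ennreal (exp (real n * (\<rho> - degree_threshold - e))) \<le>
        ennreal (exp (real n * \<beta>)) * ennreal (exp (real n * (- threshold - e / 2)))"
        using exps(1) by (simp add: ennreal_mult[symmetric] ennreal_leI)
      also have "\<dots> \<le> ennreal (exp (real n * \<beta>)) * mean_power n"
        using elim by (intro mult_left_mono) auto
      finally show "ennreal (exp (real n * (\<rho> - degree_threshold - e))) \<le> palm_mean_degree (M n) n (T n) (X n) (X0 n)"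
        unfolding ED .
    next
      have "ennreal (exp (real n * \<beta>)) * mean_power n \<le>
        ennreal (exp (real n * \<beta>)) * ennreal (exp (real n * (- threshold + e / 2)))"
        using elim by (intro mult_left_mono) auto
      also have "\<dots> \<le> ennreal (exp (real n * (\<rho> - degree_threshold + e)))"
        using exps(2) by (simp add: ennreal_mult[symmetric] ennreal_leI)
      finally show "palm_mean_degree (M n) n (T n) (X n) (X0 n) \<le> ennreal (exp (real n * (\<rho> - degree_threshold + e)))"
        unfolding ED .
    qed
  qed
qed

lemma palm_mean_degree_exp_fast:
  fixes M :: "nat \<Rightarrow> 'a measure" and T X X0
  defines "ED \<equiv> (\<lambda>n. palm_mean_degree (M n) n (T n) (X n) (X0 n))"
  assumes intensity: "r \<longlonglongrightarrow> \<rho>"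
    and process: "\<And>n. 1 \<le> n \<Longrightarrow>
      palm_marked_poisson_process (M n) n (exp (real n * r n)) (Q n) (T n) (X n) (X0 n)"
  shows "\<rho> < degree_threshold \<Longrightarrow> tends_to_zero_exp_fast ED"
    and "degree_threshold < \<rho> \<Longrightarrow> tends_to_infinity_exp_fast ED"
proof -
  have bounds: "\<forall>\<^sub>F n in sequentially. ennreal (exp (real n * (\<rho> - degree_threshold - d))) \<le> ED n \<and>
    ED n \<le> ennreal (exp (real n * (\<rho> - degree_threshold + d)))" if "0 < d" for d
    unfolding ED_def by (rule palm_mean_degree_bounds[OF intensity process that])
  {
    assume less: "\<rho> < degree_threshold"
    \<comment> \<open>Half of the gap is given up as error, the other half is the exponential
      rate.\<close>
    define d where "d = (degree_threshold - \<rho>) / 2"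
    have "0 < d" and d: "\<rho> - degree_threshold + d = - d" using less by (simp_all add: d_def field_simps)
    then show "tends_to_zero_exp_fast ED"
      using bounds[of d] unfolding tends_to_zero_exp_fast_def d
      by (intro exI[of _ d]) (auto simp: mult.commute elim!: eventually_mono)
  next
    assume less: "degree_threshold < \<rho>"
    define d where "d = (\<rho> - degree_threshold) / 2"
    have "0 < d" and d: "\<rho> - degree_threshold - d = d" using less by (simp_all add: d_def field_simps)
    then show "tends_to_infinity_exp_fast ED"
      using bounds[of d] unfolding tends_to_infinity_exp_fast_def d
      by (intro exI[of _ d]) (auto simp: mult.commute elim!: eventually_mono)
  }
qed

lemma is_degree_threshold: "is_degree_threshold Q degree_threshold"
  unfolding is_degree_threshold_def
  by (auto intro!: tends_to_zero_exp_fast_imp_tendsto tends_to_infinity_exp_fast_imp_tendsto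
    palm_mean_degree_exp_fast)

end

theorem theorem2:
  fixes N :: "nat \<Rightarrow> 'b measure" and Xbar :: "nat \<Rightarrow> 'b \<Rightarrow> real"
    and M :: "nat \<Rightarrow> 'a measure"
    and T :: "nat \<Rightarrow> nat \<Rightarrow> 'a \<Rightarrow> point" and X :: "nat \<Rightarrow> nat \<Rightarrow> 'a \<Rightarrow> real"
    and X0 :: "nat \<Rightarrow> 'a \<Rightarrow> real"
    and r :: "nat \<Rightarrow> real" and \<rho> :: real
    and I :: "real \<Rightarrow> ennreal" and Rstar \<gamma> :: real
  defines "Q \<equiv> (\<lambda>n. distr (N n) borel (Xbar n))"
    and "ED \<equiv> (\<lambda>n. palm_mean_degree (M n) n (T n) (X n) (X0 n))"
  assumes Xbar_space: "\<And>n. n \<ge> 1 \<Longrightarrow> prob_space (N n)"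
    and Xbar_measurable: "\<And>n. n \<ge> 1 \<Longrightarrow> Xbar n \<in> borel_measurable (N n)"
    and Xbar_nonneg: "\<And>n. n \<ge> 1 \<Longrightarrow> AE \<omega> in N n. 0 \<le> Xbar n \<omega>"
    and intensity: "r \<longlonglongrightarrow> \<rho>"
    and process: "\<And>n. n \<ge> 1 \<Longrightarrow>
      palm_marked_poisson_process (M n) n (exp (real n * r n)) (Q n) (T n) (X n) (X0 n)"
    and mean: "(\<lambda>n. \<integral>\<^sup>+ \<omega>. ennreal (Xbar n \<omega>) \<partial>N n) \<longlonglongrightarrow> ennreal Rstar"
    and Rstar_pos: "0 < Rstar"
    and ldp: "large_deviations_principle Q I"
    and good: "good_rate_function I"
    and conv: "convex_rate_function I"
    and gamma: "\<gamma> > 1"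
    and moment: "limsup (\<lambda>n. eroot n (\<integral>\<^sup>+ \<omega>. ennreal (Xbar n \<omega> powr (\<gamma> * real n)) \<partial>N n)) < \<top>"
  shows "\<exists>\<tau>::real.
    ereal \<tau> = ereal (- (1 / 2) * ln (2 * pi * exp 1)) +
      (INF R\<in>{2 * Rstar..}. 2 * enn2ereal (I (R / 2)) - ereal (ln R)) \<and>
    is_degree_threshold Q \<tau> \<and>
    (\<rho> < \<tau> \<longrightarrow> tends_to_zero_exp_fast ED) \<and>
    (\<tau> < \<rho> \<longrightarrow> tends_to_infinity_exp_fast ED) \<and>
    (\<rho> < \<tau> \<or> \<tau> < \<rho> \<longrightarrow>
      (\<lambda>n. elog (ED n) / ereal (real n)) \<longlonglongrightarrow> ereal (\<rho> - \<tau>))"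
proof -
  obtain C where C: "0 < C"
    "\<forall>\<^sub>F n in sequentially. (\<integral>\<^sup>+ \<omega>. ennreal (Xbar n \<omega> powr (\<gamma> * real n)) \<partial>N n) \<le> ennreal (C ^ n)"
    using eventually_moment_bound[OF moment] by blast
  \<comment> \<open>\<open>Xbar 0\<close> need not be measurable, so the transfer to the law starts
    at \<open>n = 1\<close>; the limits are insensitive to this.\<close>
  have Q_integral: "(\<integral>\<^sup>+x. f x \<partial>Q n) = (\<integral>\<^sup>+\<omega>. f (Xbar n \<omega>) \<partial>N n)"
    if "1 \<le> n" "f \<in> borel_measurable borel" for n f
    unfolding Q_def using that Xbar_measurable by (intro nn_integral_distr) auto
  interpret radius_laws Q I Rstar \<gamma> C
  proof (rule radius_laws.intro)
    show "sets (Q n) = sets borel" for n by (simp add: Q_def)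
    show "prob_space (Q n)" if "1 \<le> n" for n
      unfolding Q_def using that Xbar_space Xbar_measurable by (intro prob_space.prob_space_distr) auto
    show "AE x in Q n. 0 \<le> x" if "1 \<le> n" for n
      unfolding Q_def using that Xbar_nonneg Xbar_measurable by (subst AE_distr_iff) auto
    show "(\<lambda>n. \<integral>\<^sup>+x. ennreal x \<partial>Q n) \<longlonglongrightarrow> ennreal Rstar"
      using mean by (rule Lim_transform_eventually)
        (auto intro!: eventually_mono[OF eventually_ge_at_top[of 1]] simp: Q_integral)
    show "\<forall>\<^sub>F n in sequentially. (\<integral>\<^sup>+x. ennreal (x powr (\<gamma> * real n)) \<partial>Q n) \<le> ennreal (C ^ n)"
      using C(2) eventually_ge_at_top[of 1] by eventually_elim (simp add: Q_integral)
  qed (fact ldp good conv Rstar_pos gamma C)+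
  have "ereal degree_threshold = ereal (- (1 / 2) * ln (2 * pi * exp 1)) +
      (INF R\<in>{2 * Rstar..}. 2 * enn2ereal (I (R / 2)) - ereal (ln R))"
    unfolding threshold[symmetric] degree_threshold_def by simp
  moreover have "(\<lambda>n. elog (ED n) / ereal (real n)) \<longlonglongrightarrow> ereal (\<rho> - degree_threshold)"
    unfolding ED_def by (rule elog_rate_tendsto) (rule palm_mean_degree_bounds[OF intensity process])
  ultimately show ?thesis
    using is_degree_threshold palm_mean_degree_exp_fast[OF intensity process] unfolding ED_def by blast
qed

end
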